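(* Let $n\ge 2$, $\gamma>0$, $\alpha=\frac{2}{1+\gamma}$, and let $Cone_{\Sigma}\subseteq\mathbb{R}^n$ be a Lipschitz epigraphical cone with frequency $\phi=\phi_\Sigma$. Let $f:Cone_\Sigma\to\mathbb{R}$ satisfy $f(X)\ge\lambda$ for all $X\in Cone_\Sigma$, for some constant $\lambda>0$. If $\alpha\ge\phi$, then there is no global solution of $$-\Delta u=f(X)u^{-\gamma}\ \text{ and }\ u>0\ \text{ in } Cone_\Sigma,\qquad u=0\ \text{ on }\partial Cone_\Sigma .$$
   Context: Lipschitz epigraphical cone: for an open set $\Sigma\subseteq\partial B_1\subset\mathbb{R}^n$, let $Cone_\Sigma=\{X\in\mathbb{R}^n\setminus\{0\}: X/|X|\in\Sigma\}$. It is called a Lipschitz epigraphical cone (in the $\vec e_n$-direction) if there is a Lipschitz function $g:\mathbb{R}^{n-1}\to\mathbb{R}$ with $Cone_\Sigma=\{(x',x_n): x_n>g(x')\}$. Frequency: let $\lambda_\Sigma=\inf_{F\in C_0^\infty(\Sigma),F\neq0}\frac{\int_\Sigma|\nabla F|^2d\theta}{\int_\Sigma F^2d\theta}$ be the first Dirichlet eigenvalue of the Laplace–Beltrami operator on $\Sigma$. The frequency $\phi_\Sigma>0$ is the unique positive solution of $\phi_\Sigma(\phi_\Sigma+n-2)=\lambda_\Sigma$. A global solution means a classical solution: $u\in C^2(Cone_\Sigma)\cap C^0(\overline{Cone_\Sigma})$ satisfying the equation pointwise, positive in the cone and zero on its boundary. *)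

theory Defs
  imports "HOL-Analysis.Analysis"
begin

definition partial_deriv :: "'a::euclidean_space \<Rightarrow> ('a \<Rightarrow> real) \<Rightarrow> 'a \<Rightarrow> real" where
  "partial_deriv i f x = frechet_derivative f (at x) i"

text \<open>The class \<open>C\<^sup>k(U)\<close>; the set \<open>U\<close> is meant to be open.\<close>

fun Ck_on :: "nat \<Rightarrow> 'a::euclidean_space set \<Rightarrow> ('a \<Rightarrow> real) \<Rightarrow> bool" where
  "Ck_on 0 U f \<longleftrightarrow> continuous_on U f"
| "Ck_on (Suc k) U f \<longleftrightarrow>
     (\<forall>x\<in>U. f differentiable (at x)) \<and> (\<forall>i\<in>Basis. Ck_on k U (partial_deriv i f))"

definition Cinf_on :: "'a::euclidean_space set \<Rightarrow> ('a \<Rightarrow> real) \<Rightarrow> bool" where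
  "Cinf_on U f \<longleftrightarrow> (\<forall>k. Ck_on k U f)"

definition laplacian :: "('a::euclidean_space \<Rightarrow> real) \<Rightarrow> 'a \<Rightarrow> real" where
  "laplacian f x = (\<Sum>i\<in>Basis. partial_deriv i (partial_deriv i f) x)"

definition Cone :: "'a::euclidean_space set \<Rightarrow> 'a set" where
  "Cone \<Sigma> = {X. X \<noteq> 0 \<and> X /\<^sub>R norm X \<in> \<Sigma>}"

text \<open>
  The space \<open>\<real>\<^sup>n\<close> is split as \<open>\<real>\<^sup>n\<^sup>-\<^sup>1 \<times> \<real>\<close>, with points \<open>(x', x\<^sub>n)\<close>, where
  \<open>n - 1 = CARD('m)\<close>.  The norm on the product type is the Euclidean norm of \<open>\<real>\<^sup>n\<close>.
\<close>

definition lipschitz_epigraphical_cone :: "((real ^ 'm) \<times> real) set \<Rightarrow> bool" where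
  "lipschitz_epigraphical_cone \<Sigma> \<longleftrightarrow>
     openin (top_of_set (sphere 0 1)) \<Sigma> \<and>
     (\<exists>g :: real ^ 'm \<Rightarrow> real. (\<exists>L. L-lipschitz_on UNIV g) \<and> Cone \<Sigma> = {(x', xn). g x' < xn})"

text \<open>
  The surface measure \<open>d\<theta>\<close> on \<open>\<partial>B\<^sub>1\<close>, regarded as a Borel measure on the ambient space:
  \<open>\<sigma>(A) = n \<cdot> |{X \<in> B\<^sub>1. X \<noteq> 0 \<and> X/|X| \<in> A}|\<close>, which is the polar-coordinates definition.
\<close>

definition sphere_measure :: "'a::euclidean_space measure" where
  "sphere_measure = scale_measure (of_nat DIM('a))
     (distr (restrict_space lborel (ball 0 1 - {0})) borel (\<lambda>X. X /\<^sub>R norm X))"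

text \<open>
  Smoothness on a relatively open subset of the sphere, in the usual sense for a submanifold:
  every point has a neighbourhood in which the function has a smooth ambient extension.
\<close>

definition smooth_on_sphere :: "'a::euclidean_space set \<Rightarrow> ('a \<Rightarrow> real) \<Rightarrow> bool" where
  "smooth_on_sphere \<Sigma> F \<longleftrightarrow>
     (\<forall>\<theta>\<in>\<Sigma>. \<exists>U G. open U \<and> \<theta> \<in> U \<and> Cinf_on U G \<and> (\<forall>\<omega>\<in>U \<inter> \<Sigma>. F \<omega> = G \<omega>))"

definition Cinf_compact_support :: "'a::euclidean_space set \<Rightarrow> ('a \<Rightarrow> real) \<Rightarrow> bool" where
  "Cinf_compact_support \<Sigma> F \<longleftrightarrow>
     smooth_on_sphere \<Sigma> F \<and> (\<exists>K. compact K \<and> K \<subseteq> \<Sigma> \<and> (\<forall>\<theta>\<in>\<Sigma> - K. F \<theta> = 0))"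

text \<open>
  The Riemannian gradient: the tangent vector at \<open>\<theta>\<close> representing the derivative of \<open>F\<close> along the
  sphere.  The derivative within \<open>\<Sigma>\<close> is determined only up to its value in the normal direction;
  the condition that \<open>v\<close> be tangent makes \<open>v\<close> unique.
\<close>

definition sphere_grad :: "'a::euclidean_space set \<Rightarrow> ('a \<Rightarrow> real) \<Rightarrow> 'a \<Rightarrow> 'a" where
  "sphere_grad \<Sigma> F \<theta> =
     (THE v. v \<bullet> \<theta> = 0 \<and> (F has_derivative (\<lambda>h. v \<bullet> h)) (at \<theta> within \<Sigma>))"

lemma sphere_grad_unique:
  fixes v w \<theta> :: "'a::euclidean_space"
  assumes \<Sigma>: "openin (top_of_set (sphere 0 1)) \<Sigma>" "\<theta> \<in> \<Sigma>"
    and v: "v \<bullet> \<theta> = 0" "(F has_derivative (\<lambda>h. v \<bullet> h)) (at \<theta> within \<Sigma>)"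
    and w: "w \<bullet> \<theta> = 0" "(F has_derivative (\<lambda>h. w \<bullet> h)) (at \<theta> within \<Sigma>)"
  shows "v = w"
proof (rule ccontr)
  assume "v \<noteq> w"
  define e where "e = (v - w) /\<^sub>R norm (v - w)"
  have ne: "norm e = 1" and e\<theta>: "e \<bullet> \<theta> = 0"
    using \<open>v \<noteq> w\<close> v(1) w(1) by (auto simp: e_def inner_diff_left)
  have n\<theta>: "norm \<theta> = 1"
    using \<Sigma> openin_imp_subset by fastforce
  define c where "c = (\<lambda>t::real. cos t *\<^sub>R \<theta> + sin t *\<^sub>R e)"
  have c0: "c 0 = \<theta>" by (simp add: c_def)
  have csph: "c t \<in> sphere 0 1" for t
  proof -
    have "(norm (c t))\<^sup>2 = (cos t)\<^sup>2 * (norm \<theta>)\<^sup>2 + (sin t)\<^sup>2 * (norm e)\<^sup>2"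
      using e\<theta> unfolding c_def power2_norm_eq_inner
      by (simp add: inner_add_left inner_add_right inner_commute power2_eq_square algebra_simps)
    then have "(norm (c t))\<^sup>2 = 1"
      by (simp add: ne n\<theta>)
    then show ?thesis by (simp add: power2_eq_1_iff) (smt (verit) norm_ge_zero)
  qed
  have dc: "(c has_derivative (\<lambda>s. s *\<^sub>R e)) (at 0)"
    unfolding c_def by (auto intro!: derivative_eq_intros)
  have contc: "continuous_on UNIV c"
    unfolding c_def by (intro continuous_intros)
  obtain T where T: "open T" "\<Sigma> = T \<inter> sphere 0 1"
    using \<Sigma>(1) by (auto simp: openin_open)
  have "open (c -` T)" using contc T(1) by (simp add: open_vimage)
  define V where "V = c -` T"
  have V: "open V" "0 \<in> V" "c ` V \<subseteq> \<Sigma>"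
    using \<open>open (c -` T)\<close> c0 \<Sigma>(2) T csph by (auto simp: V_def)
  have dcV: "(c has_derivative (\<lambda>s. s *\<^sub>R e)) (at 0 within V)"
    using dc has_derivative_at_withinI by blast
  have *: "((\<lambda>t. F (c t)) has_derivative (\<lambda>s. u \<bullet> (s *\<^sub>R e))) (at 0)"
    if "(F has_derivative (\<lambda>h. u \<bullet> h)) (at \<theta> within \<Sigma>)" for u
  proof -
    have "(F has_derivative (\<lambda>h. u \<bullet> h)) (at (c 0) within c ` V)"
      using that V(3) c0 has_derivative_subset by metis
    from has_derivative_in_compose[OF dcV this]
    show ?thesis using V(1,2) at_within_open by metis
  qed
  have "(\<lambda>s. v \<bullet> (s *\<^sub>R e)) = (\<lambda>s. w \<bullet> (s *\<^sub>R e))"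
    using has_derivative_unique[OF *[OF v(2)] *[OF w(2)]] .
  then have "v \<bullet> e = w \<bullet> e" by (metis scaleR_one)
  then have "(v - w) \<bullet> (v - w) = 0"
    using \<open>v \<noteq> w\<close> by (simp add: e_def inner_diff_left)
  then show False using \<open>v \<noteq> w\<close> by simp
qed

lemma sphere_grad_eqI:
  assumes "openin (top_of_set (sphere 0 1)) \<Sigma>" "\<theta> \<in> \<Sigma>"
    and "v \<bullet> \<theta> = 0" "(F has_derivative (\<lambda>h. v \<bullet> h)) (at \<theta> within \<Sigma>)"
  shows "sphere_grad \<Sigma> F \<theta> = v"
  unfolding sphere_grad_def
  by (rule the_equality) (use assms sphere_grad_unique[OF assms(1,2)] in blast)+

definition dirichlet_eigenvalue :: "'a::euclidean_space set \<Rightarrow> real" where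
  "dirichlet_eigenvalue \<Sigma> =
     (INF F \<in> {F. Cinf_compact_support \<Sigma> F \<and> (\<exists>\<theta>\<in>\<Sigma>. F \<theta> \<noteq> 0)}.
        (LINT \<theta>:\<Sigma>|sphere_measure. (norm (sphere_grad \<Sigma> F \<theta>))\<^sup>2) /
        (LINT \<theta>:\<Sigma>|sphere_measure. (F \<theta>)\<^sup>2))"

definition frequency :: "'a::euclidean_space set \<Rightarrow> real" where
  "frequency \<Sigma> =
     (THE \<phi>. 0 < \<phi> \<and> \<phi> * (\<phi> + real DIM('a) - 2) = dirichlet_eigenvalue \<Sigma>)"

text \<open>
  Functions on the cone are total functions on the ambient space; the values of \<open>f\<close> outside the cone
  and of \<open>u\<close> outside its closure are irrelevant.
\<close>

definition global_solution ::
    "real \<Rightarrow> ('a::euclidean_space \<Rightarrow> real) \<Rightarrow> 'a set \<Rightarrow> ('a \<Rightarrow> real) \<Rightarrow> bool" where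
  "global_solution \<gamma> f \<Sigma> u \<longleftrightarrow>
     Ck_on 2 (Cone \<Sigma>) u \<and> continuous_on (closure (Cone \<Sigma>)) u \<and>
     (\<forall>X\<in>Cone \<Sigma>. - laplacian u X = f X * u X powr (- \<gamma>) \<and> 0 < u X) \<and>
     (\<forall>X\<in>frontier (Cone \<Sigma>). u X = 0)"

end

theory Submission
  imports Defs
begin

text \<open>
  If \<open>u\<close> is a solution, then \<open>v = ln u\<close> satisfies \<open>\<Delta>v + |\<nabla>v|\<^sup>2 + \<lambda> exp (- p v) \<le> 0\<close> with \<open>p = 1 + \<gamma>\<close>, and
  so do its dilations \<open>v (e\<^sup>t x) - \<alpha> t\<close>, because \<open>\<alpha> p = 2\<close>. Average these over the shell
  \<open>1/2 < |x| < 1\<close> with weight \<open>F\<^sup>2\<close>, where \<open>F\<close> is a test function on \<open>\<Sigma>\<close>, extended to be homogeneous of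
  degree zero, whose Rayleigh quotient is below \<open>\<alpha> (\<alpha> + n - 2) + \<epsilon>\<close>. Integrating by parts along the
  spheres and using Jensen's inequality, the average \<open>Y t\<close> satisfies
  \<open>Y'' + (2 \<alpha> + n - 2) Y' \<le> \<epsilon> - (\<lambda>/4) exp (- p Y)\<close> on the whole line. A Keller--Osserman argument gives
  \<open>(\<lambda>/4) exp (- p Y 0) \<le> \<epsilon>\<close>. But \<open>Y 0\<close> is bounded above by the maximum of \<open>ln u\<close> on the shell,
  which does not depend on \<open>\<epsilon>\<close>. Almost minimising test functions thus replace the eigenfunction.
\<close>

text \<open>The eigenvalue is only an infimum, and an eigenfunction would reach the boundary of the
  cone, where \<open>v\<close> tends to minus infinity. Test functions with compact support in
  \<Sigma> keep every integral on a compact part of the cone. The logarithm pays for this: as in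
  Barta's inequality, the tangential part of |\<nabla>v|^2 completes the square with the cross term
  that \<nabla>F creates, and what remains is the Dirichlet energy of F. The radial part (x
  \<bullet> \<nabla>v)^2 is replaced by its tangent at the slope \<alpha>, the slope of the
  logarithm of a function homogeneous of degree \<alpha>. This gives both the damping 2 \<alpha> + n
  - 2 and the constant \<alpha> (\<alpha> + n - 2), which \<alpha> \<ge> \<phi> places above the
  eigenvalue. For \<alpha> = \<phi> there is no margin left, so an arbitrarily small \<epsilon> has
  to be tolerated and then beaten by the exponential term. The measure on the sphere is defined
  through volumes, so spherical integrals are obtained as limits of volume integrals over the shell.
  The weights of the shell have to be differentiable for the integration by parts, hence the
  approximation of its indicator.\<close>

section \<open>A differential inequality on the line\<close>

text \<open>If \<open>L2\<close> were positive, \<open>L1\<close> would be positive just to the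
  right of its zero \<open>t\<close>, and the mean value theorem would lift \<open>L\<close> above
  its maximum.\<close>

lemma DERIV2_local_max:
  fixes L L1 :: "real \<Rightarrow> real" and L2 :: real
  assumes ab: "a < t" "t < b"
    and L: "\<And>s. a < s \<Longrightarrow> s < b \<Longrightarrow> DERIV L s :> L1 s"
    and L1: "DERIV L1 t :> L2"
    and max: "\<And>s. a < s \<Longrightarrow> s < b \<Longrightarrow> L s \<le> L t"
  shows "L1 t = 0" "L2 \<le> 0"
proof -
  define d where "d = min (t - a) (b - t)"
  have d: "d > 0" using ab by (auto simp: d_def)
  show z: "L1 t = 0"
    by (rule DERIV_local_max[OF L[OF ab] d]) (auto simp: d_def abs_if split: if_splits intro!: max)
  show "L2 \<le> 0"
  proof (rule ccontr)
    assume "\<not> L2 \<le> 0"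
    then obtain e where e: "e > 0" "\<And>h. 0 < h \<Longrightarrow> h < e \<Longrightarrow> L1 t < L1 (t + h)"
      using DERIV_pos_inc_right[OF L1] by force
    define h where "h = min (e / 2) ((b - t) / 2)"
    have h: "0 < h" "h < e" "t + h < b" using e(1) ab by (auto simp: h_def min_def field_simps)
    obtain z where z': "t < z" "z < t + h" "L (t + h) - L t = (t + h - t) * L1 z"
      using MVT2[of t "t + h" L L1] h ab L by (smt (verit))
    have "L1 z > 0" using e(2)[of "z - t"] z' h z by auto
    then have "L (t + h) > L t" using z'(3) h(1) by (smt (verit) mult_pos_pos)
    with max[of "t + h"] h ab show False by auto
  qed
qed

text \<open>
  A one-dimensional Keller--Osserman estimate: the maximum of \<open>(R\<^sup>2 - t\<^sup>2) exp (- p Y t / 2)\<close> over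
  \<open>[-R, R]\<close> is attained inside, where the first two derivatives of its logarithm are controlled.
\<close>

lemma exp_ode_bound_interval:
  fixes Y Y1 Y2 :: "real \<Rightarrow> real"
  assumes p: "p > 0" and A: "A \<ge> 0" and l: "l > 0" and eps: "eps \<ge> 0" and R: "R > 0"
    and Y: "\<And>t. DERIV Y t :> Y1 t" and Y1: "\<And>t. DERIV Y1 t :> Y2 t"
    and ode: "\<And>t. Y2 t + A * Y1 t \<le> eps - l * exp (- p * Y t)"
  shows "l * R ^ 4 * exp (- p * Y 0) \<le> eps * R ^ 4 + (2 / p) * (4 * R\<^sup>2 + 2 * A * R ^ 3)"
proof -
  define Q where "Q t = (R\<^sup>2 - t\<^sup>2) * exp (- p * Y t / 2)" for t
  have cY: "continuous_on UNIV Y" using Y DERIV_continuous_on by blast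
  have "continuous_on {-R..R} Q"
    unfolding Q_def by (intro continuous_intros continuous_on_subset[OF cY]) auto
  then obtain t where t: "t \<in> {-R..R}" "\<And>s. s \<in> {-R..R} \<Longrightarrow> Q s \<le> Q t"
    using continuous_attains_sup[of "{-R..R}" Q] R by auto
  have Q0: "Q 0 = R\<^sup>2 * exp (- p * Y 0 / 2)" by (simp add: Q_def)
  have Q0p: "Q 0 > 0" using R by (simp add: Q0)
  have Qt: "Q t \<ge> Q 0" using t(2)[of 0] R by auto
  have sq: "0 < R\<^sup>2 - s\<^sup>2" if "-R < s" "s < R" for s
  proof -
    have "0 < (R - s) * (R + s)" using that by (intro mult_pos_pos) auto
    then show ?thesis by (simp add: algebra_simps power2_eq_square)
  qed
  have "t \<noteq> R" "t \<noteq> -R" using Q0p Qt by (auto simp: Q_def)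
  then have t': "-R < t" "t < R" using t(1) by auto
  \<comment> \<open>The logarithm of \<open>Q\<close> separates the two factors, so
    \<open>Y1\<close> and \<open>Y2\<close> enter linearly.\<close>
  define L where "L s = ln (R\<^sup>2 - s\<^sup>2) - p * Y s / 2" for s
  define L1 where "L1 s = - 2 * s / (R\<^sup>2 - s\<^sup>2) - p * Y1 s / 2" for s
  define y where "y = R\<^sup>2 - t\<^sup>2"
  have y: "y > 0" using sq t' by (simp add: y_def)
  have lnQ: "L s = ln (Q s)" if "-R < s" "s < R" for s
    using sq[OF that] by (simp add: L_def Q_def ln_mult)
  have dL: "DERIV L s :> L1 s" if "-R < s" "s < R" for s
    unfolding L_def L1_def using sq[OF that] 
    by (auto intro!: derivative_eq_intros Y simp: field_simps)
  have dL1: "DERIV L1 t :> - 2 / y - 4 * t\<^sup>2 / y\<^sup>2 - p * Y2 t / 2"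
  proof -
    have yn: "R\<^sup>2 - t\<^sup>2 \<noteq> 0" using y by (simp add: y_def)
    have "DERIV L1 t :> ((- 2) * (R\<^sup>2 - t\<^sup>2) - (- 2 * t) * (- (2 * t))) /
        ((R\<^sup>2 - t\<^sup>2) * (R\<^sup>2 - t\<^sup>2)) - p * Y2 t / 2"
      unfolding L1_def using yn
      by (auto intro!: derivative_eq_intros Y1) (simp add: divide_simps)
    also have "((- 2) * (R\<^sup>2 - t\<^sup>2) - (- 2 * t) * (- (2 * t))) / ((R\<^sup>2 - t\<^sup>2) * (R\<^sup>2 - t\<^sup>2))
        = - 2 / y - 4 * t\<^sup>2 / y\<^sup>2"
      using y unfolding y_def[symmetric] by (simp add: field_simps power2_eq_square)
    finally show ?thesis .
  qed
  have mx: "L s \<le> L t" if "-R < s" "s < R" for s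
    using that t(2)[of s] lnQ[OF that] lnQ[OF t'] sq[OF that] sq[OF t']
    by (auto simp: Q_def)
  from DERIV2_local_max[OF t' dL dL1 mx]
  have 1: "- 2 * t / y - p * Y1 t / 2 = 0" and 2: "- 2 / y - 4 * t\<^sup>2 / y\<^sup>2 - p * Y2 t / 2 \<le> 0"
    by (auto simp: L1_def y_def)
  have Y1t: "Y1 t = - 4 * t / (p * y)" using 1 p y by (simp add: field_simps)
  have Y2t: "Y2 t \<ge> - (2 / p) * (2 / y + 4 * t\<^sup>2 / y\<^sup>2)"
    using 2 p by (simp add: field_simps)
  have "l * exp (- p * Y t) \<le> eps + (2 / p) * (2 / y + 4 * t\<^sup>2 / y\<^sup>2) + A * (4 * t / (p * y))"
    using ode[of t] Y1t Y2t by simp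
  \<comment> \<open>The factor \<open>y\<^sup>2\<close> clears the denominators and turns the
    exponential into \<open>(Q t)\<^sup>2\<close>, which dominates
    \<open>(Q 0)\<^sup>2\<close>.\<close>
  then have "y\<^sup>2 * (l * exp (- p * Y t)) \<le>
      y\<^sup>2 * (eps + (2 / p) * (2 / y + 4 * t\<^sup>2 / y\<^sup>2) + A * (4 * t / (p * y)))"
    using y by (intro mult_left_mono) auto
  also have "\<dots> = eps * y\<^sup>2 + (2 / p) * (2 * y + 4 * t\<^sup>2 + 2 * A * t * y)"
    using y p by (simp add: field_simps power2_eq_square)
  also have "\<dots> \<le> eps * R ^ 4 + (2 / p) * (4 * R\<^sup>2 + 2 * A * R ^ 3)"
  proof -
    have yR: "y \<le> R\<^sup>2" by (simp add: y_def)
    have "y\<^sup>2 \<le> (R\<^sup>2)\<^sup>2" using y yR by (intro power_mono) auto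
    then have a: "eps * y\<^sup>2 \<le> eps * R ^ 4" using eps by (intro mult_left_mono) auto
    have tR: "t\<^sup>2 \<le> R\<^sup>2" using y by (simp add: y_def)
    have b: "2 * y + 4 * t\<^sup>2 \<le> 4 * R\<^sup>2" using tR by (simp add: y_def)
    have "t * y \<le> R * R\<^sup>2" using t' y yR R by (intro mult_mono) auto
    then have "A * (t * y) \<le> A * R ^ 3"
      using A by (intro mult_left_mono) (auto simp: power3_eq_cube power2_eq_square)
    then have c: "2 * y + 4 * t\<^sup>2 + 2 * A * t * y \<le> 4 * R\<^sup>2 + 2 * A * R ^ 3" using b by simp
    have "(2 / p) * (2 * y + 4 * t\<^sup>2 + 2 * A * t * y) \<le> (2 / p) * (4 * R\<^sup>2 + 2 * A * R ^ 3)"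
      using c p by (intro mult_left_mono) auto
    with a show ?thesis by simp
  qed
  finally have 3: "y\<^sup>2 * (l * exp (- p * Y t)) \<le> \<dots>" .
  have sqe: "(exp (- p * Y s / 2))\<^sup>2 = exp (- p * Y s)" for s
    by (simp add: power2_eq_square flip: exp_add)
  have "(Q t)\<^sup>2 = y\<^sup>2 * exp (- p * Y t)" "(Q 0)\<^sup>2 = R ^ 4 * exp (- p * Y 0)"
    by (simp_all only: Q_def y_def power_mult_distrib sqe) simp_all
  moreover have "(Q 0)\<^sup>2 \<le> (Q t)\<^sup>2" using Q0p Qt by (intro power_mono) auto
  ultimately have "l * (R ^ 4 * exp (- p * Y 0)) \<le> l * (y\<^sup>2 * exp (- p * Y t))"
    using l by simp
  with 3 show ?thesis by (simp add: mult_ac)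
qed

text \<open>After division by \<open>R ^ 4\<close> the boundary terms of the interval bound are O(1
  / R). Letting \<open>R\<close> grow is possible because the inequality holds for all real
  \<open>t\<close>, that is, on all scales of the cone.\<close>

lemma exp_ode_bound:
  fixes Y Y1 Y2 :: "real \<Rightarrow> real"
  assumes p: "p > 0" and A: "A \<ge> 0" and l: "l > 0" and eps: "eps \<ge> 0"
    and Y: "\<And>t. DERIV Y t :> Y1 t" and Y1: "\<And>t. DERIV Y1 t :> Y2 t"
    and ode: "\<And>t. Y2 t + A * Y1 t \<le> eps - l * exp (- p * Y t)"
  shows "l * exp (- p * Y 0) \<le> eps"
proof (rule field_le_epsilon)
  fix d :: real assume d: "d > 0"
  define C where "C = (2 / p) * (4 + 2 * A)"
  have C: "C > 0" using p A by (auto simp: C_def intro!: mult_pos_pos)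
  \<comment> \<open>\<open>1 \<le> R\<close> allows \<open>R\<^sup>2\<close> to be absorbed in
    \<open>R ^ 3\<close>; \<open>C / d \<le> R\<close> gives
    \<open>C * R ^ 3 \<le> d * R ^ 4\<close>.\<close>
  define R where "R = max 1 (C / d)"
  have R: "R \<ge> 1" "C / d \<le> R" by (auto simp: R_def)
  have "l * R ^ 4 * exp (- p * Y 0) \<le> eps * R ^ 4 + (2 / p) * (4 * R\<^sup>2 + 2 * A * R ^ 3)"
    by (rule exp_ode_bound_interval) (use assms R in auto)
  also have "\<dots> \<le> eps * R ^ 4 + C * R ^ 3"
  proof -
    have "R\<^sup>2 \<le> R ^ 3" using R by (intro power_increasing) auto
    then have "(2 / p) * (4 * R\<^sup>2 + 2 * A * R ^ 3) \<le> (2 / p) * (4 * R ^ 3 + 2 * A * R ^ 3)"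
      using p by (intro mult_left_mono) auto
    then show ?thesis by (simp add: C_def algebra_simps)
  qed
  also have "C * R ^ 3 \<le> d * R ^ 4"
  proof -
    have "C \<le> d * R" using R(2) d by (simp add: field_simps)
    then have "C * R ^ 3 \<le> (d * R) * R ^ 3" using R(1) by (intro mult_right_mono) auto
    then show ?thesis by (simp add: power_Suc[symmetric] mult_ac eval_nat_numeral)
  qed
  finally have "R ^ 4 * (l * exp (- p * Y 0)) \<le> R ^ 4 * (eps + d)" by (simp add: algebra_simps)
  moreover have "R ^ 4 > 0" using R(1) by simp
  ultimately show "l * exp (- p * Y 0) \<le> eps + d" using mult_le_cancel_left_pos by blast
qed

section \<open>Integrals of compactly supported functions\<close>

lemma continuous_on_UNIV_zero_outside:
  fixes f :: "'a::topological_space \<Rightarrow> 'b::real_normed_vector"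
  assumes "open U" "closed S" "S \<subseteq> U" "continuous_on U f" "\<And>x. x \<notin> S \<Longrightarrow> f x = 0"
  shows "continuous_on UNIV f"
proof -
  have "continuous_on (- S) f"
    by (rule continuous_on_cong[THEN iffD2, OF refl _ continuous_on_const[of _ 0]]) (simp add: assms)
  then have "continuous_on (U \<union> - S) f"
    using assms by (intro continuous_on_open_Un) auto
  moreover have "U \<union> - S = UNIV" using assms(3) by blast
  ultimately show ?thesis by simp
qed

text \<open>A bridge from the Lebesgue integral to the integral over a box, where differentiation
  under the integral sign is carried out.\<close>

lemma compact_support_integral:
  fixes f :: "'a::euclidean_space \<Rightarrow> real"
  assumes "compact S" "continuous_on UNIV f" "\<And>x. x \<notin> S \<Longrightarrow> f x = 0"
  shows integrable_compact_support: "integrable lborel f"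
    and integral_compact_support_cbox: "S \<subseteq> cbox a b \<Longrightarrow> integral\<^sup>L lborel f = integral (cbox a b) f"
proof -
  have "(\<lambda>x. indicator S x *\<^sub>R f x) = f" using assms(3) by (fastforce simp: indicator_def)
  then show i: "integrable lborel f"
    using borel_integrable_compact[OF assms(1), of f] assms(2) continuous_on_subset by fastforce
  assume "S \<subseteq> cbox a b"
  then have "integral UNIV f = integral (cbox a b) f"
    using assms(3) integral_spike_set by (smt (verit) integral_restrict_UNIV integral_cong subsetD)
  with integral_lborel[OF i] show "integral\<^sup>L lborel f = integral (cbox a b) f" by simp
qed

lemma DERIV_integral_compact_support:
  fixes f f' :: "real \<Rightarrow> 'a::euclidean_space \<Rightarrow> real"
  assumes T: "open T" "convex T" "t0 \<in> T" and S: "compact S"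
    and f: "\<And>t x. t \<in> T \<Longrightarrow> ((\<lambda>t. f t x) has_field_derivative f' t x) (at t)"
    and f0: "\<And>t x. t \<in> T \<Longrightarrow> x \<notin> S \<Longrightarrow> f t x = 0"
    and cf: "\<And>t. t \<in> T \<Longrightarrow> continuous_on UNIV (f t)"
    and cf': "continuous_on (T \<times> UNIV) (\<lambda>(t, x). f' t x)"
  shows "DERIV (\<lambda>t. LINT x|lborel. f t x) t0 :> (LINT x|lborel. f' t0 x)"
proof -
  obtain a b where ab: "S \<subseteq> cbox a b"
    using compact_imp_bounded[OF S] bounded_subset_cbox_symmetric by metis
  have f'0: "f' t x = 0" if "t \<in> T" "x \<notin> S" for t x
  proof -
    have "((\<lambda>t. 0) has_field_derivative f' t x) (at t)"
      by (rule has_field_derivative_transform_within_open[OF f[OF that(1)] T(1) that(1)])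
        (simp add: f0 that)
    then show ?thesis using DERIV_unique DERIV_const by blast
  qed
  have "((\<lambda>t. integral (cbox a b) (f t)) has_field_derivative integral (cbox a b) (f' t0)) (at t0 within T)"
  proof (rule leibniz_rule_field_derivative[OF _ _ _ T(3,2)])
    show "((\<lambda>x. f x t) has_field_derivative f' x t) (at x within T)" if "x \<in> T" for x t
      using f[OF that] has_field_derivative_at_within by blast
    show "f x integrable_on cbox a b" if "x \<in> T" for x
      using cf[OF that] continuous_on_subset integrable_continuous by blast
    show "continuous_on (T \<times> cbox a b) (\<lambda>(x, t). f' x t)"
      using cf' by (rule continuous_on_subset) auto
  qed
  then have "DERIV (\<lambda>t. integral (cbox a b) (f t)) t0 :> integral (cbox a b) (f' t0)"
    using T at_within_open by metis
  then have "DERIV (\<lambda>t. integral\<^sup>L lborel (f t)) t0 :> integral (cbox a b) (f' t0)"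
    by (rule has_field_derivative_transform_within_open[OF _ T(1,3)])
      (simp add: integral_compact_support_cbox[OF S cf f0 ab])
  moreover have "continuous_on UNIV (f' t0)"
    using continuous_on_compose2[OF cf', of UNIV "Pair t0"] T(3) by (fastforce intro!: continuous_intros)
  then have "integral\<^sup>L lborel (f' t0) = integral (cbox a b) (f' t0)"
    by (rule integral_compact_support_cbox[OF S _ _ ab]) (simp add: f'0 T(3))
  ultimately show ?thesis by simp
qed

lemma has_derivative_zero_outside_support:
  fixes h :: "'a::real_normed_vector \<Rightarrow> 'b::real_normed_vector"
  assumes "closed S" "\<And>x. x \<notin> S \<Longrightarrow> h x = 0" "x \<notin> S"
  shows "(h has_derivative (\<lambda>_. 0)) (at x)"
proof -
  have "((\<lambda>_. 0::'b) has_derivative (\<lambda>_. 0)) (at x)" by simp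
  then show ?thesis
    by (rule has_derivative_transform_within_open[of _ _ _ _ "- S"])
      (use assms in \<open>auto simp: open_Compl\<close>)
qed

text \<open>Functions such as \<open>ln u\<close> are meaningful only inside the cone. Truncation to
  \<open>0\<close> outside \<open>U\<close> gives a total function, continuous because it already
  vanishes on \<open>U - S\<close>; the later integrands have this form.\<close>

lemma integrable_if_compact_support:
  fixes f :: "'a::euclidean_space \<Rightarrow> real"
  assumes "open U" "compact S" "S \<subseteq> U" "continuous_on U f" "\<And>x. x \<in> U - S \<Longrightarrow> f x = 0"
  shows continuous_if_compact_support: "continuous_on UNIV (\<lambda>x. if x \<in> U then f x else 0)"
    and "integrable lborel (\<lambda>x. if x \<in> U then f x else 0)"
proof -
  have "continuous_on U (\<lambda>x. if x \<in> U then f x else 0)"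
    by (rule continuous_on_cong[THEN iffD2, OF refl _ assms(4)]) simp
  then show "continuous_on UNIV (\<lambda>x. if x \<in> U then f x else 0)"
    by (rule continuous_on_UNIV_zero_outside[OF assms(1) compact_imp_closed[OF assms(2)] assms(3)])
      (use assms(5) in auto)
  then show "integrable lborel (\<lambda>x. if x \<in> U then f x else 0)"
    by (rule integrable_compact_support[OF assms(2)]) (use assms(5) in auto)
qed

text \<open>By translation invariance the integral of \<open>h (x + t *\<^sub>R e)\<close> does not
  depend on \<open>t\<close>; its derivative at \<open>t = 0\<close> is the integral in question.
  Summed over a basis, this is the divergence theorem for compactly supported fields.\<close>

lemma integral_directional_derivative_zero:
  fixes h :: "'a::euclidean_space \<Rightarrow> real"
  assumes U: "open U" and S: "compact S" "S \<subseteq> U" and h0: "\<And>x. x \<notin> S \<Longrightarrow> h x = 0"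
    and h: "\<And>x. x \<in> U \<Longrightarrow> (h has_derivative D x) (at x)"
    and D: "continuous_on U (\<lambda>x. D x e)"
  shows "has_bochner_integral lborel (\<lambda>x. if x \<in> U then D x e else 0) 0"
proof -
  define d where "d x = (if x \<in> U then D x e else 0)" for x
  have clS: "closed S" using S compact_imp_closed by blast
  have d0: "d x = 0" if "x \<notin> S" for x
  proof (cases "x \<in> U")
    case True
    have "(h has_derivative (\<lambda>_. 0)) (at x)"
      by (rule has_derivative_zero_outside_support[OF clS _ that]) (rule h0)
    with h[OF True] have "D x = (\<lambda>_. 0)" by (rule has_derivative_unique)
    then show ?thesis by (simp add: d_def)
  qed (simp add: d_def)
  have "continuous_on U d" by (rule continuous_on_cong[THEN iffD2, OF refl _ D]) (simp add: d_def)
  then have cd: "continuous_on UNIV d"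
    using continuous_on_UNIV_zero_outside U clS S(2) d0 by blast
  have hd: "\<exists>D'. (h has_derivative D') (at x) \<and> D' e = d x" for x
  proof (cases "x \<in> U")
    case True then show ?thesis using h by (auto simp: d_def)
  next
    case False
    have "(h has_derivative (\<lambda>_. 0)) (at x)"
      by (rule has_derivative_zero_outside_support[OF clS]) (use h0 False S(2) in auto)
    with False show ?thesis by (auto simp: d_def)
  qed
  have ch: "continuous_on UNIV h"
    using hd has_derivative_continuous continuous_at_imp_continuous_on by blast
  obtain B where B: "S \<subseteq> cball 0 B" using compact_imp_bounded[OF S(1)] unfolding bounded_iff by (auto simp: subset_iff)
  define f where "f t x = h (x + t *\<^sub>R e)" for t x
  have "DERIV (\<lambda>t. LINT x|lborel. f t x) 0 :> (LINT x|lborel. d (x + 0 *\<^sub>R e))"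
  \<comment> \<open>The enlarged ball contains the supports of all translates with \<open>t\<close>
    between -1 and 1.\<close>
  proof (rule DERIV_integral_compact_support[of "{-1<..<1}" 0 "cball 0 (B + norm e)"])
    fix t :: real and x :: 'a assume t: "t \<in> {-1<..<1}"
    obtain D' where D': "(h has_derivative D') (at (x + t *\<^sub>R e))" "D' e = d (x + t *\<^sub>R e)"
      using hd by blast
    have "((\<lambda>t. x + t *\<^sub>R e) has_derivative (\<lambda>s. s *\<^sub>R e)) (at t)"
      by (auto intro!: derivative_eq_intros)
    from has_derivative_compose[OF this D'(1)]
    show "((\<lambda>t. f t x) has_field_derivative d (x + t *\<^sub>R e)) (at t)"
      using linear_cmul[OF has_derivative_linear[OF D'(1)]] D'(2)
      by (simp add: f_def has_field_derivative_def mult.commute[of _ "d _"])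
    assume "x \<notin> cball 0 (B + norm e)"
    moreover have "norm (t *\<^sub>R e) \<le> norm e" using t by (auto intro!: mult_left_le_one_le)
    then have "norm x \<le> norm (x + t *\<^sub>R e) + norm e" 
      using norm_triangle_ineq4[of "x + t *\<^sub>R e" "t *\<^sub>R e"] by simp
    ultimately have "x + t *\<^sub>R e \<notin> S" using B by auto
    then show "f t x = 0" by (simp add: f_def h0)
  next
    fix t :: real
    show "continuous_on UNIV (f t)" unfolding f_def
      by (intro continuous_on_compose2[OF ch] continuous_intros) auto
  next
    show "continuous_on ({-1<..<1} \<times> UNIV) (\<lambda>(t, x). d (x + t *\<^sub>R e))"
      unfolding split_beta by (intro continuous_on_compose2[OF cd] continuous_intros) auto
  qed auto
  moreover have "(LINT x|lborel. f t x) = (LINT x|lborel. h x)" for t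
  proof -
    have "(LINT x|lborel. h x) = (LINT x|distr lborel borel ((+) (t *\<^sub>R e)). h x)"
      by (simp add: lborel_distr_plus)
    also have "\<dots> = (LINT x|lborel. h (t *\<^sub>R e + x))"
      by (rule integral_distr) (use borel_measurable_continuous_onI[OF ch] in auto)
    finally show ?thesis by (simp add: f_def add.commute)
  qed
  ultimately have "(LINT x|lborel. d x) = 0" using DERIV_unique[OF _ DERIV_const] by simp
  then have "has_bochner_integral lborel d 0"
    using integrable_compact_support[OF S(1) cd] d0 by (auto simp: has_bochner_integral_iff)
  then show ?thesis by (simp add: d_def[abs_def])
qed

section \<open>The energy inequality along spheres\<close>

text \<open>With N the square of \<open>norm x\<close> and \<tau> the component of \<open>g\<close>
  orthogonal to \<open>x\<close>, the vector \<open>w\<close> is N (F \<tau> - d). The claim is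
  \<open>w \<bullet> w \<ge> 0\<close> divided by N, that is, Young's inequality for the cross
  term.\<close>

lemma tangential_cauchy_schwarz:
  fixes x g d :: "'a::real_inner"
  assumes "d \<bullet> x = 0"
  shows "F\<^sup>2 * ((g \<bullet> x)\<^sup>2 - (norm x)\<^sup>2 * (norm g)\<^sup>2) + 2 * F * (norm x)\<^sup>2 * (g \<bullet> d) \<le> (norm x)\<^sup>2 * (norm d)\<^sup>2"
proof (cases "x = 0")
  case False
  define N where "N = (norm x)\<^sup>2"
  have N: "N > 0" using False by (simp add: N_def)
  define w where "w = F *\<^sub>R (N *\<^sub>R g - (g \<bullet> x) *\<^sub>R x) - N *\<^sub>R d"
  have xx: "x \<bullet> x = N" by (simp add: N_def power2_norm_eq_inner)
  have dx: "x \<bullet> d = 0" using assms by (simp add: inner_commute)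
  have "w \<bullet> w = N * (F\<^sup>2 * (N * (g \<bullet> g) - (g \<bullet> x)\<^sup>2) - 2 * F * N * (g \<bullet> d) + N * (d \<bullet> d))"
    unfolding w_def using xx assms dx
    by (simp add: inner_diff_left inner_diff_right inner_commute[of x g] inner_commute[of d g])
      (simp add: algebra_simps power2_eq_square)
  then have "0 \<le> F\<^sup>2 * (N * (g \<bullet> g) - (g \<bullet> x)\<^sup>2) - 2 * F * N * (g \<bullet> d) + N * (d \<bullet> d)"
    using N inner_ge_zero[of w] by (metis zero_le_mult_iff not_le)
  then show ?thesis by (simp add: N_def[symmetric] power2_norm_eq_inner[of g] power2_norm_eq_inner[of d] algebra_simps)
qed simp

text \<open>The first line of the left side averages to the differential expression in
  \<open>t\<close>; the second is the divergence of a tangential field and integrates to zero. In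
  their sum \<open>Hxx\<close> cancels and the coefficient of \<open>g \<bullet> x\<close> becomes 2
  \<alpha>.\<close>

lemma supersolution_pointwise:
  fixes x g d :: "'a::real_inner" and \<alpha> n F \<rho> lam E trH Hxx :: real
  assumes d: "d \<bullet> x = 0" and \<rho>: "\<rho> \<ge> 0" and le: "trH + (norm g)\<^sup>2 + lam * E \<le> 0"
    and lam: "lam \<ge> 0" "E \<ge> 0" and x: "norm x \<ge> 1/2"
  shows "(Hxx + g \<bullet> x + (2 * \<alpha> + n - 2) * (g \<bullet> x - \<alpha>)) * (\<rho> * F\<^sup>2)
      + (2 * \<rho> * F * ((norm x)\<^sup>2 * (g \<bullet> d)) + \<rho> * F\<^sup>2 * ((norm x)\<^sup>2 * trH - Hxx + (1 - n) * (g \<bullet> x)))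
     \<le> \<rho> * ((norm x)\<^sup>2 * (norm d)\<^sup>2) - \<alpha> * (\<alpha> + n - 2) * (\<rho> * F\<^sup>2) - lam / 4 * (E * (\<rho> * F\<^sup>2))"
proof -
  define N where "N = (norm x)\<^sup>2"
  have "(1/2)\<^sup>2 \<le> (norm x)\<^sup>2" using x by (intro power_mono) auto
  then have N: "N \<ge> 1/4" by (simp add: N_def power2_eq_square)
  have "N * (trH + (norm g)\<^sup>2 + lam * E) \<le> 0" using N le by (simp add: mult_nonneg_nonpos)
  \<comment> \<open>The factor 1/4 in the final estimate is the squared inner radius of the
    shell.\<close>
  moreover have "1/4 * (lam * E) \<le> N * (lam * E)" using N lam by (intro mult_right_mono) auto
  ultimately have 1: "N * trH \<le> - N * (norm g)\<^sup>2 - lam / 4 * E" by (simp add: algebra_simps)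
  \<comment> \<open>The square of \<open>g \<bullet> x - \<alpha>\<close> is nonnegative, so the
    radial term may be linearised at the slope \<alpha>.\<close>
  have 2: "N * trH + 2 * \<alpha> * (g \<bullet> x) - \<alpha>\<^sup>2 + lam / 4 * E \<le> (g \<bullet> x)\<^sup>2 - N * (norm g)\<^sup>2"
    using 1 zero_le_power2[of "g \<bullet> x - \<alpha>"] by (simp add: power2_diff algebra_simps)
  have "F\<^sup>2 * (N * trH + 2 * \<alpha> * (g \<bullet> x) - \<alpha>\<^sup>2 + lam / 4 * E) + 2 * F * (N * (g \<bullet> d)) \<le> N * (norm d)\<^sup>2"
    using mult_left_mono[OF 2, of "F\<^sup>2"] tangential_cauchy_schwarz[OF d, of F g]
    by (simp add: N_def algebra_simps)
  from mult_left_mono[OF this \<rho>] show ?thesis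
    unfolding N_def[symmetric] by (simp add: algebra_simps power2_eq_square)
qed

lemma linear_eq_sum_Basis:
  fixes L :: "'a::euclidean_space \<Rightarrow> 'b::real_vector"
  assumes "linear L"
  shows "L x = (\<Sum>i\<in>Basis. (x \<bullet> i) *\<^sub>R L i)"
proof -
  have "L x = L (\<Sum>i\<in>Basis. (x \<bullet> i) *\<^sub>R i)" by (simp add: euclidean_representation)
  also have "\<dots> = (\<Sum>i\<in>Basis. (x \<bullet> i) *\<^sub>R L i)"
    using assms by (simp add: linear_sum linear_cmul)
  finally show ?thesis .
qed

text \<open>The Hessian is known to be continuous for each fixed direction; expanding in the basis
  extends this to directions that move with the point, as in \<open>H x x\<close>.\<close>

lemma continuous_on_linear_family:
  fixes L :: "'a::topological_space \<Rightarrow> 'b::euclidean_space \<Rightarrow> 'c::real_normed_vector"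
  assumes "\<And>x. x \<in> U \<Longrightarrow> linear (L x)" "\<And>e. continuous_on U (\<lambda>x. L x e)" "continuous_on U f"
  shows "continuous_on U (\<lambda>x. L x (f x))"
proof -
  have "continuous_on U (\<lambda>x. \<Sum>i\<in>Basis. (f x \<bullet> i) *\<^sub>R L x i)"
    by (intro continuous_intros assms(2,3))
  then show ?thesis
    by (rule continuous_on_cong[THEN iffD1, rotated 2]) (simp_all add: linear_eq_sum_Basis[OF assms(1)])
qed

text \<open>The divergence of \<open>\<rho> F\<^sup>2 W\<close>, with \<open>W\<close> tangent to
  the spheres, is added to the left side at no cost and then estimated pointwise. This integrates by
  parts on all spheres at once, without surface integrals.\<close>

lemma supersolution_energy_inequality:
  fixes U S :: "'a::euclidean_space set" and v F \<rho> r :: "'a \<Rightarrow> real" and g dF :: "'a \<Rightarrow> 'a"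
    and H :: "'a \<Rightarrow> 'a \<Rightarrow> 'a" and lam p \<alpha> :: real
  defines "n \<equiv> real DIM('a)"
  assumes U: "open U" and S: "compact S" "S \<subseteq> U" "\<And>x. x \<in> S \<Longrightarrow> norm x \<ge> 1/2"
    and v: "\<And>x. x \<in> U \<Longrightarrow> (v has_derivative (\<lambda>h. g x \<bullet> h)) (at x)"
    and g: "\<And>x. x \<in> U \<Longrightarrow> (g has_derivative H x) (at x)"
    and cH: "\<And>e. continuous_on U (\<lambda>x. H x e)"
    and le: "\<And>x. x \<in> U \<Longrightarrow> (\<Sum>i\<in>Basis. H x i \<bullet> i) + (norm (g x))\<^sup>2 + lam * exp (- p * v x) \<le> 0"
    and lam: "lam \<ge> 0"
    and F: "\<And>x. x \<in> U \<Longrightarrow> (F has_derivative (\<lambda>h. dF x \<bullet> h)) (at x)"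
    and cdF: "continuous_on U dF" and dFx: "\<And>x. x \<in> U \<Longrightarrow> dF x \<bullet> x = 0"
    and \<rho>: "\<And>x. (\<rho> has_derivative (\<lambda>h. r x * (x \<bullet> h))) (at x)" "\<And>x. \<rho> x \<ge> 0"
    and r: "continuous_on UNIV r"
    and supp: "\<And>x. x \<in> U - S \<Longrightarrow> \<rho> x = 0 \<or> F x = 0 \<and> dF x = 0"
  shows "(LINT x|lborel. (if x \<in> U then
            (H x x \<bullet> x + g x \<bullet> x + (2 * \<alpha> + n - 2) * (g x \<bullet> x - \<alpha>)) * (\<rho> x * (F x)\<^sup>2) else 0))
     \<le> (LINT x|lborel. (if x \<in> U then \<rho> x * ((norm x)\<^sup>2 * (norm (dF x))\<^sup>2) else 0))
       - \<alpha> * (\<alpha> + n - 2) * (LINT x|lborel. (if x \<in> U then \<rho> x * (F x)\<^sup>2 else 0))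
       - lam / 4 * (LINT x|lborel. (if x \<in> U then exp (- p * v x) * (\<rho> x * (F x)\<^sup>2) else 0))"
proof -
  \<comment> \<open>\<open>W x\<close> is \<open>(norm x)\<^sup>2\<close> times the tangential
    gradient of \<open>v\<close>. The functions \<open>DW\<close> and \<open>c\<close> below are the
    derivative of \<open>W\<close> and the gradient of \<open>\<rho> F\<^sup>2\<close>.\<close>
  define W where "W x = (norm x)\<^sup>2 *\<^sub>R g x - (g x \<bullet> x) *\<^sub>R x" for x
  define DW where "DW x h = (2 * (x \<bullet> h)) *\<^sub>R g x + (norm x)\<^sup>2 *\<^sub>R H x h
      - ((H x h \<bullet> x + g x \<bullet> h) *\<^sub>R x + (g x \<bullet> x) *\<^sub>R h)" for x h
  define c where "c x = (r x * (F x)\<^sup>2) *\<^sub>R x + (2 * \<rho> x * F x) *\<^sub>R dF x" for x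
  define \<Phi> where "\<Phi> x = (if x \<in> U then \<rho> x * (F x)\<^sup>2 else 0)" for x
  define D where "D i x h = (c x \<bullet> h) * (W x \<bullet> i) + \<rho> x * (F x)\<^sup>2 * (DW x h \<bullet> i)" for i x h
  have cv: "continuous_on U v"
    by (rule has_derivative_continuous_on, rule has_derivative_at_withinI, erule v)
  have cg: "continuous_on U g"
    by (rule has_derivative_continuous_on, rule has_derivative_at_withinI, erule g)
  have cF: "continuous_on U F"
    by (rule has_derivative_continuous_on, rule has_derivative_at_withinI, erule F)
  have c\<rho>: "continuous_on UNIV \<rho>"
    by (rule has_derivative_continuous_on, rule has_derivative_at_withinI, rule \<rho>(1))
  note c\<rho>' = continuous_on_subset[OF c\<rho> subset_UNIV] and cr' = continuous_on_subset[OF r subset_UNIV]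
  have lin: "linear (H x)" if "x \<in> U" for x using g[OF that] has_derivative_linear by blast
  have cHx: "continuous_on U (\<lambda>x. H x x \<bullet> x)"
    by (intro continuous_on_inner continuous_on_linear_family[of U H "\<lambda>x. x"] lin cH continuous_on_id)
  have d\<Phi>: "(\<Phi> has_derivative (\<lambda>h. c x \<bullet> h)) (at x)" if "x \<in> U" for x
  proof (rule has_derivative_transform_within_open[OF _ U that])
    show "((\<lambda>x. \<rho> x * (F x)\<^sup>2) has_derivative (\<lambda>h. c x \<bullet> h)) (at x)"
      by (rule derivative_eq_intros refl \<rho>(1) F[OF that])+
        (auto simp: c_def inner_add_left algebra_simps power2_eq_square)
  qed (simp add: \<Phi>_def)
  have dW: "(W has_derivative (\<lambda>h. DW x h)) (at x)" if "x \<in> U" for x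
    unfolding W_def power2_norm_eq_inner
    by (rule derivative_eq_intros refl g[OF that])+
      (auto simp: DW_def power2_norm_eq_inner algebra_simps inner_commute)
  have div0: "has_bochner_integral lborel (\<lambda>x. if x \<in> U then D i x i else 0) 0" for i
  proof (rule integral_directional_derivative_zero[OF U S(1,2), where h = "\<lambda>x. \<Phi> x * (W x \<bullet> i)" and D = "D i" and e = i])
    show "\<Phi> x * (W x \<bullet> i) = 0" if "x \<notin> S" for x
      using supp[of x] that by (auto simp: \<Phi>_def)
    show "((\<lambda>x. \<Phi> x * (W x \<bullet> i)) has_derivative D i x) (at x)" if "x \<in> U" for x
      by (rule derivative_eq_intros refl d\<Phi>[OF that] dW[OF that])+
        (use that in \<open>auto simp: D_def \<Phi>_def algebra_simps\<close>)
    show "continuous_on U (\<lambda>x. D i x i)"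
      unfolding D_def c_def W_def DW_def
      by (intro continuous_intros cH cg cF cdF c\<rho>' cr')
  qed
  have div: "has_bochner_integral lborel (\<lambda>x. \<Sum>i\<in>Basis. if x \<in> U then D i x i else 0) 0"
    using has_bochner_integral_sum[of Basis lborel "\<lambda>i x. if x \<in> U then D i x i else 0" "\<lambda>_. 0"] div0
    by auto
  have sumD: "(\<Sum>i\<in>Basis. D i x i) = 2 * \<rho> x * F x * ((norm x)\<^sup>2 * (g x \<bullet> dF x))
      + \<rho> x * (F x)\<^sup>2 * ((norm x)\<^sup>2 * (\<Sum>i\<in>Basis. H x i \<bullet> i) - H x x \<bullet> x + (1 - n) * (g x \<bullet> x))"
    if x: "x \<in> U" for x
  proof -
    \<comment> \<open>Since \<open>W x\<close> is orthogonal to \<open>x\<close>, the derivative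
      \<open>r\<close> of the radial weight disappears, and so no cost of the cut-off is
      left.\<close>
    have a: "(\<Sum>i\<in>Basis. (c x \<bullet> i) * (W x \<bullet> i)) = 2 * \<rho> x * F x * ((norm x)\<^sup>2 * (g x \<bullet> dF x))"
      unfolding euclidean_inner[symmetric] c_def W_def power2_norm_eq_inner
      using dFx[OF x]
      by (simp add: inner_add_left inner_diff_right algebra_simps inner_commute)
    have b: "(\<Sum>i\<in>Basis. (H x i \<bullet> x) * (x \<bullet> i)) = H x x \<bullet> x"
      using arg_cong[OF linear_eq_sum_Basis[OF lin[OF x], of x], of "\<lambda>y. y \<bullet> x"]
      by (simp add: inner_sum_left mult.commute)
    \<comment> \<open>The coefficient \<open>1 - n\<close> of \<open>g x \<bullet> x\<close> is 2
      from differentiating the squared norm, minus 1 from \<open>g x \<bullet> h\<close>, minus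
      \<open>n\<close> from the trace of the identity.\<close>
    have "(\<Sum>i\<in>Basis. DW x i \<bullet> i) = (\<Sum>i\<in>Basis. 2 * ((x \<bullet> i) * (g x \<bullet> i)) + (norm x)\<^sup>2 * (H x i \<bullet> i)
        - (H x i \<bullet> x) * (x \<bullet> i) - (g x \<bullet> i) * (x \<bullet> i) - g x \<bullet> x)"
      by (rule sum.cong) (auto simp: DW_def inner_add_left inner_diff_left algebra_simps inner_Basis)
    also have "\<dots> = 2 * (x \<bullet> g x) + (norm x)\<^sup>2 * (\<Sum>i\<in>Basis. H x i \<bullet> i) - H x x \<bullet> x - g x \<bullet> x - n * (g x \<bullet> x)"
      using inner_commute[of x "g x"]
      by (simp add: sum.distrib sum_subtractf b euclidean_inner[symmetric] n_def flip: sum_distrib_left)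
    finally have "(\<Sum>i\<in>Basis. DW x i \<bullet> i)
       = (norm x)\<^sup>2 * (\<Sum>i\<in>Basis. H x i \<bullet> i) - H x x \<bullet> x + (1 - n) * (g x \<bullet> x)"
      by (simp add: algebra_simps inner_commute)
    with a show ?thesis by (simp add: D_def sum.distrib flip: sum_distrib_left)
  qed
  have s1: "\<rho> x * y * (F x)\<^sup>2 = 0" "y * (\<rho> x * (F x)\<^sup>2) = 0" "\<rho> x * (F x)\<^sup>2 = 0" 
      "\<rho> x * ((norm x)\<^sup>2 * (norm (dF x))\<^sup>2) = 0" if "x \<in> U - S" for x y
    using supp[OF that] by auto
  note int = integrable_if_compact_support(2)[OF U S(1,2)]
  let ?L = "\<lambda>x. if x \<in> U then (H x x \<bullet> x + g x \<bullet> x + (2 * \<alpha> + n - 2) * (g x \<bullet> x - \<alpha>)) * (\<rho> x * (F x)\<^sup>2) else 0"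
  let ?R1 = "\<lambda>x. if x \<in> U then \<rho> x * ((norm x)\<^sup>2 * (norm (dF x))\<^sup>2) else 0"
  let ?R2 = "\<lambda>x. if x \<in> U then \<rho> x * (F x)\<^sup>2 else 0"
  let ?R3 = "\<lambda>x. if x \<in> U then exp (- p * v x) * (\<rho> x * (F x)\<^sup>2) else 0"
  let ?D = "\<lambda>x. \<Sum>i\<in>Basis. if x \<in> U then D i x i else 0"
  have iL: "integrable lborel ?L"
    by (rule int) (use s1 in \<open>auto intro!: continuous_intros cg cF c\<rho>' cHx\<close>)
  have iR1: "integrable lborel ?R1"
    by (rule int) (use s1 in \<open>auto intro!: continuous_intros cdF c\<rho>'\<close>)
  have iR2: "integrable lborel ?R2"
    by (rule int) (use s1 in \<open>auto intro!: continuous_intros cF c\<rho>'\<close>)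
  have iR3: "integrable lborel ?R3"
    by (rule int) (use s1 in \<open>auto intro!: continuous_intros cv cF c\<rho>'\<close>)
  have "integral\<^sup>L lborel ?L = (LINT x|lborel. ?L x + ?D x)"
    using Bochner_Integration.integral_add[OF iL, of ?D] div by (simp add: has_bochner_integral_iff)
  also have "\<dots> \<le> (LINT x|lborel. ?R1 x - \<alpha> * (\<alpha> + n - 2) * ?R2 x - lam / 4 * ?R3 x)"
  proof (rule integral_mono)
    show "integrable lborel (\<lambda>x. ?L x + ?D x)"
      using iL div by (auto simp: has_bochner_integral_iff)
    show "integrable lborel (\<lambda>x. ?R1 x - \<alpha> * (\<alpha> + n - 2) * ?R2 x - lam / 4 * ?R3 x)"
      using iR1 iR2 iR3 by auto
    fix x :: 'a
    show "?L x + ?D x \<le> ?R1 x - \<alpha> * (\<alpha> + n - 2) * ?R2 x - lam / 4 * ?R3 x"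
    proof (cases "x \<in> U")
      case x: True
      show ?thesis
      proof (cases "x \<in> S")
        case True
        have "exp (- p * v x) \<ge> 0" by simp
        from supersolution_pointwise[OF dFx[OF x] \<rho>(2) le[OF x] lam this S(3)[OF True], where \<alpha> = \<alpha> and n = n]
        show ?thesis using x by (simp only: if_True sumD)
      next
        case False
        then have "\<rho> x = 0 \<or> F x = 0 \<and> dF x = 0" using supp x by blast
        then show ?thesis using x by (auto simp only: if_True sumD) auto
      qed
    qed simp
  qed
  also have "\<dots> = integral\<^sup>L lborel ?R1 - \<alpha> * (\<alpha> + n - 2) * integral\<^sup>L lborel ?R2 - lam / 4 * integral\<^sup>L lborel ?R3"
    using iR1 iR2 iR3 by simp
  finally show ?thesis .
qed

section \<open>Dilations and the weighted mean\<close>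

text \<open>At \<open>y = exp t *\<^sub>R x\<close> the derivative in \<open>t\<close> is
  \<open>Dw y y\<close>, once more a function of the dilated point. The same rule therefore applies
  a second time, to \<open>\<lambda>x. Dw x x\<close>.\<close>

lemma DERIV_dilation_integral:
  fixes w \<Phi> :: "'a::euclidean_space \<Rightarrow> real"
  assumes U: "open U" "\<And>x s. x \<in> U \<Longrightarrow> s > 0 \<Longrightarrow> s *\<^sub>R x \<in> U" and S: "compact S" "S \<subseteq> U"
    and w: "\<And>x. x \<in> U \<Longrightarrow> (w has_derivative Dw x) (at x)"
    and cDw: "continuous_on U (\<lambda>x. Dw x x)"
    and c\<Phi>: "continuous_on U \<Phi>" and \<Phi>: "\<And>x. x \<in> U - S \<Longrightarrow> \<Phi> x = 0"
  shows "DERIV (\<lambda>t. LINT x|lborel. (if x \<in> U then w (exp t *\<^sub>R x) * \<Phi> x else 0)) t :>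
      (LINT x|lborel. (if x \<in> U then Dw (exp t *\<^sub>R x) (exp t *\<^sub>R x) * \<Phi> x else 0))"
proof (rule DERIV_integral_compact_support[of UNIV t S])
  have cw: "continuous_on U w"
    by (rule has_derivative_continuous_on, rule has_derivative_at_withinI, erule w)
  show "((\<lambda>t. if x \<in> U then w (exp t *\<^sub>R x) * \<Phi> x else 0) has_real_derivative
      (if x \<in> U then Dw (exp t *\<^sub>R x) (exp t *\<^sub>R x) * \<Phi> x else 0)) (at t)" for t x
  proof (cases "x \<in> U")
    case True
    let ?y = "exp t *\<^sub>R x"
    have y: "?y \<in> U" using U(2)[OF True] by simp
    have "((\<lambda>t. exp t *\<^sub>R x) has_derivative (\<lambda>h. (h * exp t) *\<^sub>R x)) (at t)"
      by (auto intro!: derivative_eq_intros)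
    from has_derivative_compose[OF this w[OF y]]
    have "((\<lambda>t. w (exp t *\<^sub>R x)) has_derivative (\<lambda>h. Dw ?y ?y * h)) (at t)"
      using linear_cmul[OF has_derivative_linear[OF w[OF y]], of _ ?y] by (simp add: mult.commute)
    then have "DERIV (\<lambda>t. w (exp t *\<^sub>R x)) t :> Dw ?y ?y"
      by (simp add: has_field_derivative_def)
    then show ?thesis using True by (auto intro!: derivative_eq_intros)
  qed simp
  show "(if x \<in> U then w (exp t *\<^sub>R x) * \<Phi> x else 0) = 0" if "x \<notin> S" for t x
    using that \<Phi> by auto
  show "continuous_on UNIV (\<lambda>x. if x \<in> U then w (exp t *\<^sub>R x) * \<Phi> x else 0)" for t
    by (rule continuous_if_compact_support[OF U(1) S])
      (use \<Phi> U(2) in \<open>auto intro!: continuous_intros c\<Phi> continuous_on_compose2[OF cw]\<close>)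
  have "continuous_on (UNIV \<times> UNIV) (\<lambda>z. if snd z \<in> U
      then Dw (exp (fst z) *\<^sub>R snd z) (exp (fst z) *\<^sub>R snd z) * \<Phi> (snd z) else 0)"
    unfolding UNIV_Times_UNIV
  proof (rule continuous_on_UNIV_zero_outside[of "UNIV \<times> U" "UNIV \<times> S"])
    have "continuous_on (UNIV \<times> U)
        (\<lambda>z. Dw (exp (fst z) *\<^sub>R snd z) (exp (fst z) *\<^sub>R snd z) * \<Phi> (snd z))"
      using U(2) by (auto intro!: continuous_intros continuous_on_compose2[OF cDw] continuous_on_compose2[OF c\<Phi>])
    then show "continuous_on (UNIV \<times> U) (\<lambda>z. if snd z \<in> U
      then Dw (exp (fst z) *\<^sub>R snd z) (exp (fst z) *\<^sub>R snd z) * \<Phi> (snd z) else 0)"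
      by (rule continuous_on_cong[THEN iffD1, rotated 2]) auto
    show "(if snd z \<in> U then Dw (exp (fst z) *\<^sub>R snd z) (exp (fst z) *\<^sub>R snd z) * \<Phi> (snd z) else 0) = 0"
      if "z \<notin> UNIV \<times> S" for z
      using that \<Phi>[of "snd z"] by (cases z) auto
  qed (use U(1) S in \<open>auto simp: open_Times closed_Times compact_imp_closed\<close>)
  then show "continuous_on (UNIV \<times> UNIV)
     (\<lambda>(t, x). if x \<in> U then Dw (exp t *\<^sub>R x) (exp t *\<^sub>R x) * \<Phi> x else 0)"
    by (simp add: split_beta)
qed (use S in auto)

text \<open>The exponential lies above its tangent at the weighted mean \<open>y\<close>; in the
  integral of the tangent the linear term cancels by the choice of \<open>y\<close>.\<close>

lemma jensen_exp_weighted: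
  fixes w \<Phi> :: "'a \<Rightarrow> real"
  assumes i: "integrable M \<Phi>" "integrable M (\<lambda>x. w x * \<Phi> x)" "integrable M (\<lambda>x. exp (- p * w x) * \<Phi> x)"
    and \<Phi>: "\<And>x. \<Phi> x \<ge> 0" and c: "(LINT x|M. \<Phi> x) > 0"
  shows "(LINT x|M. \<Phi> x) * exp (- p * ((LINT x|M. w x * \<Phi> x) / (LINT x|M. \<Phi> x))) \<le>
     (LINT x|M. exp (- p * w x) * \<Phi> x)"
proof -
  define y where "y = (LINT x|M. w x * \<Phi> x) / (LINT x|M. \<Phi> x)"
  have "exp (- p * y) * (1 + p * y) * \<Phi> x - p * exp (- p * y) * (w x * \<Phi> x) \<le> exp (- p * w x) * \<Phi> x" for x
  proof -
    have "exp (- p * y) * (1 + (p * y - p * w x)) \<le> exp (- p * y) * exp (p * y - p * w x)"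
      by (intro mult_left_mono exp_ge_add_one_self) auto
    also have "\<dots> = exp (- p * w x)" by (simp flip: exp_add)
    finally have "(exp (- p * y) * (1 + (p * y - p * w x))) * \<Phi> x \<le> exp (- p * w x) * \<Phi> x"
      by (intro mult_right_mono \<Phi>)
    then show ?thesis by (simp add: algebra_simps)
  qed
  then have "(LINT x|M. exp (- p * y) * (1 + p * y) * \<Phi> x - p * exp (- p * y) * (w x * \<Phi> x))
     \<le> (LINT x|M. exp (- p * w x) * \<Phi> x)"
    by (intro integral_mono) (use i in auto)
  also have "(LINT x|M. exp (- p * y) * (1 + p * y) * \<Phi> x - p * exp (- p * y) * (w x * \<Phi> x))
     = exp (- p * y) * (1 + p * y) * (LINT x|M. \<Phi> x) - p * exp (- p * y) * (LINT x|M. w x * \<Phi> x)"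
    using i by simp
  also have "(LINT x|M. w x * \<Phi> x) = y * (LINT x|M. \<Phi> x)" using c by (simp add: y_def)
  finally show ?thesis unfolding y_def[symmetric] by (simp add: algebra_simps)
qed

text \<open>
  The dilations \<open>v (e\<^sup>t x) - \<alpha> t\<close> of a supersolution are supersolutions; their weighted mean, as a
  function of \<open>t\<close>, satisfies the differential inequality of \<open>exp_ode_bound\<close>.
\<close>

lemma supersolution_cone_bound:
  fixes U S :: "'a::euclidean_space set" and v F \<rho> r :: "'a \<Rightarrow> real" and g dF :: "'a \<Rightarrow> 'a"
    and H :: "'a \<Rightarrow> 'a \<Rightarrow> 'a" and lam p \<alpha> eps M :: real
  defines "n \<equiv> real DIM('a)"
  assumes U: "open U" "\<And>x s. x \<in> U \<Longrightarrow> s > 0 \<Longrightarrow> s *\<^sub>R x \<in> U"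
    and S: "compact S" "S \<subseteq> U" "\<And>x. x \<in> S \<Longrightarrow> norm x \<ge> 1/2"
    and v: "\<And>x. x \<in> U \<Longrightarrow> (v has_derivative (\<lambda>h. g x \<bullet> h)) (at x)"
    and g: "\<And>x. x \<in> U \<Longrightarrow> (g has_derivative H x) (at x)"
    and cH: "\<And>e. continuous_on U (\<lambda>x. H x e)"
    and le: "\<And>x. x \<in> U \<Longrightarrow> (\<Sum>i\<in>Basis. H x i \<bullet> i) + (norm (g x))\<^sup>2 + lam * exp (- p * v x) \<le> 0"
    and lam: "lam > 0" and p: "p > 0" "\<alpha> * p = 2" and n2: "n \<ge> 2"
    and F: "\<And>x. x \<in> U \<Longrightarrow> (F has_derivative (\<lambda>h. dF x \<bullet> h)) (at x)"
    and cdF: "continuous_on U dF" and dFx: "\<And>x. x \<in> U \<Longrightarrow> dF x \<bullet> x = 0"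
    and \<rho>: "\<And>x. (\<rho> has_derivative (\<lambda>h. r x * (x \<bullet> h))) (at x)" "\<And>x. \<rho> x \<ge> 0"
    and r: "continuous_on UNIV r"
    and supp: "\<And>x. x \<in> U - S \<Longrightarrow> \<rho> x = 0 \<or> F x = 0 \<and> dF x = 0"
    and pos: "(LINT x|lborel. (if x \<in> U then \<rho> x * (F x)\<^sup>2 else 0)) > 0"
    and Rayleigh: "(LINT x|lborel. (if x \<in> U then \<rho> x * ((norm x)\<^sup>2 * (norm (dF x))\<^sup>2) else 0)) \<le>
      (\<alpha> * (\<alpha> + n - 2) + eps) * (LINT x|lborel. (if x \<in> U then \<rho> x * (F x)\<^sup>2 else 0))"
    and eps: "eps \<ge> 0"
    and vM: "\<And>x. x \<in> S \<Longrightarrow> v x \<le> M"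
  shows "lam / 4 * exp (- p * M) \<le> eps"
proof -
  define \<Phi> where "\<Phi> x = \<rho> x * (F x)\<^sup>2" for x
  define c where "c = (LINT x|lborel. (if x \<in> U then \<Phi> x else 0))"
  define A where "A = 2 * \<alpha> + n - 2"
  have \<alpha>: "\<alpha> > 0" using p by (metis zero_less_mult_pos2 zero_less_numeral)
  have c: "c > 0" using pos unfolding c_def \<Phi>_def .
  have cF: "continuous_on U F"
    by (rule has_derivative_continuous_on, rule has_derivative_at_withinI, erule F)
  have cg: "continuous_on U g"
    by (rule has_derivative_continuous_on, rule has_derivative_at_withinI, erule g)
  have cv: "continuous_on U v"
    by (rule has_derivative_continuous_on, rule has_derivative_at_withinI, erule v)
  have c\<rho>: "continuous_on UNIV \<rho>"
    by (rule has_derivative_continuous_on, rule has_derivative_at_withinI, rule \<rho>(1))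
  have c\<Phi>: "continuous_on U \<Phi>"
    unfolding \<Phi>_def by (intro continuous_intros cF continuous_on_subset[OF c\<rho>]) auto
  have \<Phi>0: "\<Phi> x = 0" if "x \<in> U - S" for x using supp[OF that] by (auto simp: \<Phi>_def)
  have \<Phi>nn: "\<Phi> x \<ge> 0" for x using \<rho>(2) by (simp add: \<Phi>_def)
  have lin: "linear (H x)" if "x \<in> U" for x using g[OF that] has_derivative_linear by blast
  have cHx: "continuous_on U (\<lambda>x. H x x \<bullet> x)"
    by (intro continuous_on_inner continuous_on_linear_family[of U H "\<lambda>x. x"] lin cH continuous_on_id)
  let ?I = "\<lambda>f. LINT x|lborel. (if x \<in> U then f x * \<Phi> x else 0)"
  have int: "integrable lborel (\<lambda>x. if x \<in> U then f x * \<Phi> x else 0)" if "continuous_on U f" for f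
    by (rule integrable_if_compact_support(2)[OF U(1) S(1,2)])
      (use \<Phi>0 in \<open>auto intro!: continuous_intros c\<Phi> that\<close>)
  have i1: "integrable lborel (\<lambda>x. if x \<in> U then \<Phi> x else 0)"
    using int[of "\<lambda>_. 1"] by (simp only: mult_1_left continuous_on_const)
  have pull: "z * (if x \<in> U then \<Phi> x else 0) = (if x \<in> U then z * \<Phi> x else 0)" for z x
    by simp
  \<comment> \<open>The Euler derivative of \<open>v\<close> taken twice:
    \<open>g x \<bullet> x\<close> differentiated in the direction \<open>x\<close>.\<close>
  define e2 where "e2 x = H x x \<bullet> x + g x \<bullet> x" for x
  define Y where "Y t = ?I (\<lambda>x. v (exp t *\<^sub>R x)) / c - \<alpha> * t" for t
  define Y1 where "Y1 t = ?I (\<lambda>x. g (exp t *\<^sub>R x) \<bullet> (exp t *\<^sub>R x)) / c - \<alpha>" for t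
  define Y2 where "Y2 t = ?I (\<lambda>x. e2 (exp t *\<^sub>R x)) / c" for t
  have c0: "c \<noteq> 0" using c by simp
  have dI: "DERIV (\<lambda>t. ?I (\<lambda>x. v (exp t *\<^sub>R x))) t :> ?I (\<lambda>x. g (exp t *\<^sub>R x) \<bullet> (exp t *\<^sub>R x))" for t
    by (rule DERIV_dilation_integral[OF U S(1,2), where w = v and Dw = "\<lambda>x h. g x \<bullet> h"])
      (use v \<Phi>0 in \<open>auto intro!: continuous_intros cg c\<Phi>\<close>)
  have dI1: "DERIV (\<lambda>t. ?I (\<lambda>x. g (exp t *\<^sub>R x) \<bullet> (exp t *\<^sub>R x))) t :> ?I (\<lambda>x. e2 (exp t *\<^sub>R x))" for t
    unfolding e2_def
  proof (rule DERIV_dilation_integral[OF U S(1,2), where w = "\<lambda>x. g x \<bullet> x" and Dw = "\<lambda>x h. H x h \<bullet> x + g x \<bullet> h"])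
    show "((\<lambda>x. g x \<bullet> x) has_derivative (\<lambda>h. H x h \<bullet> x + g x \<bullet> h)) (at x)" if "x \<in> U" for x
      by (rule derivative_eq_intros refl g[OF that])+ (simp add: add.commute)
  qed (use \<Phi>0 in \<open>auto intro!: continuous_intros cg cHx c\<Phi>\<close>)
  have "lam / 4 * exp (- p * Y 0) \<le> eps"
  proof (rule exp_ode_bound[of p A "lam / 4" eps Y Y1 Y2])
    show "A \<ge> 0" using \<alpha> n2 by (simp add: A_def)
    show "DERIV Y t :> Y1 t" for t unfolding Y_def Y1_def
      by (auto intro!: derivative_eq_intros dI simp: c0)
    show "DERIV Y1 t :> Y2 t" for t unfolding Y1_def Y2_def
      by (auto intro!: derivative_eq_intros dI1 simp: c0)
    fix t :: real
    define s where "s = exp t"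
    have s: "s > 0" by (simp add: s_def)
    define w where "w x = v (s *\<^sub>R x) - \<alpha> * t" for x
    have sU: "s *\<^sub>R x \<in> U" if "x \<in> U" for x using U(2) that s by blast
    have cs: "continuous_on U (\<lambda>x. f (s *\<^sub>R x))" if "continuous_on U f" for f :: "'a \<Rightarrow> 'b::topological_space"
      by (rule continuous_on_compose2[OF that]) (auto intro!: continuous_intros sU)
    \<comment> \<open>Here \<open>\<alpha> * p = 2\<close> is used: the shift by
      \<open>\<alpha> * t\<close> yields exactly the factor \<open>s\<^sup>2\<close> gained by the
      Hessian and by the squared gradient, so \<open>w\<close> satisfies the inequality of
      \<open>v\<close>.\<close>
    have e: "exp (- p * w x) = s\<^sup>2 * exp (- p * v (s *\<^sub>R x))" for x
    proof -
      have "- p * w x = 2 * t + - p * v (s *\<^sub>R x)" using p by (simp add: w_def algebra_simps)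
      then have "exp (- p * w x) = exp (2 * t) * exp (- p * v (s *\<^sub>R x))" by (simp only: exp_add)
      also have "exp (2 * t) = s\<^sup>2" by (simp add: s_def power2_eq_square flip: exp_add)
      finally show ?thesis .
    qed
    have "?I (\<lambda>x. s\<^sup>2 * (H (s *\<^sub>R x) x \<bullet> x) + s * (g (s *\<^sub>R x) \<bullet> x) + A * (s * (g (s *\<^sub>R x) \<bullet> x) - \<alpha>))
      \<le> (LINT x|lborel. (if x \<in> U then \<rho> x * ((norm x)\<^sup>2 * (norm (dF x))\<^sup>2) else 0))
       - \<alpha> * (\<alpha> + n - 2) * c - lam / 4 * ?I (\<lambda>x. exp (- p * w x))"
    proof -
      have "(LINT x|lborel. (if x \<in> U then
            ((s\<^sup>2 *\<^sub>R H (s *\<^sub>R x) x) \<bullet> x + (s *\<^sub>R g (s *\<^sub>R x)) \<bullet> x +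
             (2 * \<alpha> + real DIM('a) - 2) * ((s *\<^sub>R g (s *\<^sub>R x)) \<bullet> x - \<alpha>)) * (\<rho> x * (F x)\<^sup>2) else 0))
       \<le> (LINT x|lborel. (if x \<in> U then \<rho> x * ((norm x)\<^sup>2 * (norm (dF x))\<^sup>2) else 0))
         - \<alpha> * (\<alpha> + real DIM('a) - 2) * (LINT x|lborel. (if x \<in> U then \<rho> x * (F x)\<^sup>2 else 0))
         - lam / 4 * (LINT x|lborel. (if x \<in> U then exp (- p * w x) * (\<rho> x * (F x)\<^sup>2) else 0))"
      proof (rule supersolution_energy_inequality[OF U(1) S _ _ _ _ _ F cdF dFx \<rho> r supp,
            where H = "\<lambda>x h. s\<^sup>2 *\<^sub>R H (s *\<^sub>R x) h"])
        fix x assume x: "x \<in> U"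
        have ds: "((\<lambda>x. s *\<^sub>R x) has_derivative (\<lambda>h. s *\<^sub>R h)) (at x)"
          by (auto intro!: derivative_eq_intros)
        show "(w has_derivative (\<lambda>h. (s *\<^sub>R g (s *\<^sub>R x)) \<bullet> h)) (at x)"
          unfolding w_def using has_derivative_compose[OF ds v[OF sU[OF x]]]
          by (auto intro!: derivative_eq_intros)
        show "((\<lambda>x. s *\<^sub>R g (s *\<^sub>R x)) has_derivative (\<lambda>h. s\<^sup>2 *\<^sub>R H (s *\<^sub>R x) h)) (at x)"
          using has_derivative_scaleR_right[OF has_derivative_compose[OF ds g[OF sU[OF x]]], of s]
            linear_cmul[OF lin[OF sU[OF x]], of s]
          by (simp add: power2_eq_square)
        have "s\<^sup>2 * ((\<Sum>i\<in>Basis. H (s *\<^sub>R x) i \<bullet> i) + (norm (g (s *\<^sub>R x)))\<^sup>2 + lam * exp (- p * v (s *\<^sub>R x))) \<le> 0"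
          using le[OF sU[OF x]] by (intro mult_nonneg_nonpos) auto
        then show "(\<Sum>i\<in>Basis. (s\<^sup>2 *\<^sub>R H (s *\<^sub>R x) i) \<bullet> i) + (norm (s *\<^sub>R g (s *\<^sub>R x)))\<^sup>2
            + lam * exp (- p * w x) \<le> 0"
          unfolding e by (simp add: power_mult_distrib algebra_simps sum_distrib_left)
      next
        show "continuous_on U (\<lambda>x. s\<^sup>2 *\<^sub>R H (s *\<^sub>R x) e)" for e
          by (intro continuous_intros cs[OF cH])
      qed (use lam in auto)
      then show ?thesis unfolding \<Phi>_def c_def A_def n_def inner_scaleR_left by simp
    qed
    \<comment> \<open>The powers of \<open>s\<close> move into the arguments by linearity, which
      exhibits Euler derivatives of \<open>v\<close> at \<open>s *\<^sub>R x\<close>, the integrands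
      of \<open>Y1\<close> and \<open>Y2\<close>.\<close>
    also have "?I (\<lambda>x. s\<^sup>2 * (H (s *\<^sub>R x) x \<bullet> x) + s * (g (s *\<^sub>R x) \<bullet> x) + A * (s * (g (s *\<^sub>R x) \<bullet> x) - \<alpha>))
       = c * (Y2 t + A * Y1 t)"
    proof -
      have ie: "integrable lborel (\<lambda>x. if x \<in> U then e2 (s *\<^sub>R x) * \<Phi> x else 0)"
        unfolding e2_def by (intro int cs continuous_intros cHx cg)
      have ig: "integrable lborel (\<lambda>x. if x \<in> U then (g (s *\<^sub>R x) \<bullet> (s *\<^sub>R x)) * \<Phi> x else 0)"
        by (intro int continuous_intros cs[OF cg])
      have "?I (\<lambda>x. s\<^sup>2 * (H (s *\<^sub>R x) x \<bullet> x) + s * (g (s *\<^sub>R x) \<bullet> x) + A * (s * (g (s *\<^sub>R x) \<bullet> x) - \<alpha>))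
        = (LINT x|lborel. (if x \<in> U then e2 (s *\<^sub>R x) * \<Phi> x else 0)
          + A * (if x \<in> U then (g (s *\<^sub>R x) \<bullet> (s *\<^sub>R x)) * \<Phi> x else 0)
          - A * \<alpha> * (if x \<in> U then \<Phi> x else 0))"
        by (rule Bochner_Integration.integral_cong)
          (auto simp: e2_def linear_cmul[OF lin[OF sU]] power2_eq_square algebra_simps)
      also have "\<dots> = ?I (\<lambda>x. e2 (s *\<^sub>R x)) + A * ?I (\<lambda>x. g (s *\<^sub>R x) \<bullet> (s *\<^sub>R x)) - A * \<alpha> * c"
        using ie ig i1 by (simp add: c_def)
      also have "\<dots> = c * (Y2 t + A * Y1 t)"
        using c unfolding Y2_def Y1_def s_def[symmetric] by (simp add: field_simps)
      finally show ?thesis .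
    qed
    finally have 1: "c * (Y2 t + A * Y1 t) \<le> eps * c - lam / 4 * ?I (\<lambda>x. exp (- p * w x))"
      using Rayleigh unfolding \<Phi>_def[symmetric] c_def[symmetric] by (simp add: algebra_simps)
    have cw: "continuous_on U w" unfolding w_def by (intro continuous_intros cs[OF cv])
    have Yw: "(LINT x|lborel. w x * (if x \<in> U then \<Phi> x else 0)) / c = Y t"
    proof -
      have iv: "integrable lborel (\<lambda>x. if x \<in> U then v (s *\<^sub>R x) * \<Phi> x else 0)"
        by (intro int cs[OF cv])
      have "(LINT x|lborel. w x * (if x \<in> U then \<Phi> x else 0)) =
         (LINT x|lborel. (if x \<in> U then v (s *\<^sub>R x) * \<Phi> x else 0) - \<alpha> * t * (if x \<in> U then \<Phi> x else 0))"
        by (rule Bochner_Integration.integral_cong) (auto simp: w_def algebra_simps)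
      also have "\<dots> = ?I (\<lambda>x. v (s *\<^sub>R x)) - \<alpha> * t * c" using iv i1 by (simp add: c_def)
      finally show ?thesis using c unfolding Y_def s_def[symmetric] by (simp add: field_simps)
    qed
    have "c * exp (- p * Y t) \<le> ?I (\<lambda>x. exp (- p * w x))"
    proof -
      have i2: "integrable lborel (\<lambda>x. w x * (if x \<in> U then \<Phi> x else 0))"
        unfolding pull by (rule int[OF cw])
      have i3: "integrable lborel (\<lambda>x. exp (- p * w x) * (if x \<in> U then \<Phi> x else 0))"
        unfolding pull by (intro int continuous_intros cw)
      show ?thesis
        using jensen_exp_weighted[OF i1 i2 i3] \<Phi>nn c
        unfolding c_def[symmetric] unfolding Yw unfolding pull by simp
    qed
    then have "lam / 4 * (c * exp (- p * Y t)) \<le> lam / 4 * ?I (\<lambda>x. exp (- p * w x))"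
      using lam by (intro mult_left_mono) auto
    with 1 have "c * (Y2 t + A * Y1 t) \<le> c * (eps - lam / 4 * exp (- p * Y t))"
      by (simp add: algebra_simps)
    then show "Y2 t + A * Y1 t \<le> eps - lam / 4 * exp (- p * Y t)"
      using c by simp
  qed (use p lam eps in auto)
  \<comment> \<open>At \<open>t = 0\<close> there is no dilation, so only values of \<open>v\<close>
    on \<open>S\<close> are averaged.\<close>
  moreover have "Y 0 \<le> M"
  proof -
    have "?I v \<le> ?I (\<lambda>_. M)"
    proof (rule integral_mono[OF int int])
      fix x
      show "(if x \<in> U then v x * \<Phi> x else 0) \<le> (if x \<in> U then M * \<Phi> x else 0)"
        using vM[of x] \<Phi>0[of x] \<Phi>nn[of x] by (cases "x \<in> S") (auto intro: mult_right_mono)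
    qed (auto intro: cv)
    also have "?I (\<lambda>_. M) = (LINT x|lborel. M * (if x \<in> U then \<Phi> x else 0))"
      by (rule Bochner_Integration.integral_cong) auto
    also have "\<dots> = M * c" by (simp add: c_def)
    finally show ?thesis using c unfolding Y_def exp_zero scaleR_one by (simp add: field_simps)
  qed
  then have "exp (- p * M) \<le> exp (- p * Y 0)" using p by simp
  then have "lam / 4 * exp (- p * M) \<le> lam / 4 * exp (- p * Y 0)" using lam by (intro mult_left_mono) auto
  ultimately show ?thesis by linarith
qed

section \<open>Gradients and the logarithm of a solution\<close>

definition gradient :: "('a::euclidean_space \<Rightarrow> real) \<Rightarrow> 'a \<Rightarrow> 'a" where
  "gradient f x = (\<Sum>i\<in>Basis. partial_deriv i f x *\<^sub>R i)"

lemma gradient_inner_Basis: "i \<in> Basis \<Longrightarrow> gradient f x \<bullet> i = partial_deriv i f x"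
  by (simp add: gradient_def)

lemma has_derivative_gradient:
  assumes "f differentiable (at x)"
  shows "(f has_derivative (\<lambda>h. gradient f x \<bullet> h)) (at x)"
proof -
  have f: "(f has_derivative frechet_derivative f (at x)) (at x)"
    using assms by (simp add: frechet_derivative_works)
  have "frechet_derivative f (at x) = (\<lambda>h. gradient f x \<bullet> h)"
  proof
    show "frechet_derivative f (at x) h = gradient f x \<bullet> h" for h
      using linear_eq_sum_Basis[OF has_derivative_linear[OF f], of h]
      by (simp add: gradient_def partial_deriv_def inner_sum_left inner_commute[of h] mult.commute)
  qed
  with f show ?thesis by simp
qed

lemma gradient_eqI:
  assumes "(f has_derivative (\<lambda>h. a \<bullet> h)) (at x)"
  shows "gradient f x = a"
  unfolding gradient_def partial_deriv_def frechet_derivative_at[OF assms, symmetric]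
  by (rule euclidean_representation)

lemma continuous_on_gradient:
  assumes "\<And>i. i \<in> Basis \<Longrightarrow> continuous_on U (partial_deriv i f)"
  shows "continuous_on U (gradient f)"
  unfolding gradient_def[abs_def] by (intro continuous_intros assms)

lemma Ck_on_1_D:
  assumes "Ck_on (Suc 0) U f"
  shows "\<And>x. x \<in> U \<Longrightarrow> (f has_derivative (\<lambda>h. gradient f x \<bullet> h)) (at x)"
    and "continuous_on U (gradient f)"
  using assms by (auto intro!: has_derivative_gradient continuous_on_gradient)

text \<open>The Laplacian of \<open>ln u\<close> is \<open>laplacian u x / u x\<close> minus the
  squared gradient of \<open>ln u\<close>, and the additional factor \<open>1 / u x\<close> changes
  the exponent \<gamma> into 1 + \<gamma>.\<close>

lemma log_supersolution:
  fixes u f :: "'a::euclidean_space \<Rightarrow> real"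
  assumes u: "Ck_on 2 U u" "\<And>x. x \<in> U \<Longrightarrow> u x > 0"
    and le: "\<And>x. x \<in> U \<Longrightarrow> laplacian u x \<le> - lam * u x powr (- \<gamma>)"
  obtains g :: "'a \<Rightarrow> 'a" and H :: "'a \<Rightarrow> 'a \<Rightarrow> 'a" where
    "\<And>x. x \<in> U \<Longrightarrow> ((\<lambda>x. ln (u x)) has_derivative (\<lambda>h. g x \<bullet> h)) (at x)"
    "\<And>x. x \<in> U \<Longrightarrow> (g has_derivative H x) (at x)"
    "\<And>e. continuous_on U (\<lambda>x. H x e)"
    "\<And>x. x \<in> U \<Longrightarrow> (\<Sum>i\<in>Basis. H x i \<bullet> i) + (norm (g x))\<^sup>2 + lam * exp (- (1 + \<gamma>) * ln (u x)) \<le> 0"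
proof -
  have ud: "\<And>x. x \<in> U \<Longrightarrow> u differentiable (at x)"
    and uk: "\<And>i. i \<in> Basis \<Longrightarrow> Ck_on (Suc 0) U (partial_deriv i u)"
    using u(1) by (auto simp: numeral_2_eq_2)
  define G where "G x h = (\<Sum>i\<in>Basis. (gradient (partial_deriv i u) x \<bullet> h) *\<^sub>R i)" for x h
  define g where "g x = inverse (u x) *\<^sub>R gradient u x" for x
  define H where "H x h = inverse (u x) *\<^sub>R G x h - ((gradient u x \<bullet> h) * inverse (u x)^2) *\<^sub>R gradient u x" for x h
  have du: "(u has_derivative (\<lambda>h. gradient u x \<bullet> h)) (at x)" if "x \<in> U" for x
    by (rule has_derivative_gradient[OF ud[OF that]])
  have cu: "continuous_on U u"
    by (rule has_derivative_continuous_on, rule has_derivative_at_withinI, erule du)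
  have dG: "(gradient u has_derivative G x) (at x)" if "x \<in> U" for x
  proof -
    have "gradient u = (\<lambda>x. \<Sum>i\<in>Basis. partial_deriv i u x *\<^sub>R i)" by (simp add: gradient_def[abs_def])
    then show ?thesis unfolding G_def
      by (simp only:) (intro has_derivative_sum has_derivative_scaleR_left Ck_on_1_D(1)[OF uk] that)
  qed
  have cG: "continuous_on U (\<lambda>x. G x e)" for e
    unfolding G_def by (intro continuous_intros Ck_on_1_D(2)[OF uk])
  have cgu: "continuous_on U (gradient u)"
    by (rule has_derivative_continuous_on, rule has_derivative_at_withinI, erule dG)
  have un: "u x \<noteq> 0" if "x \<in> U" for x using u(2)[OF that] by simp
  show ?thesis
  proof
    fix x assume x: "x \<in> U"
    have ux: "u x > 0" by (rule u(2)[OF x])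
    show "((\<lambda>x. ln (u x)) has_derivative (\<lambda>h. g x \<bullet> h)) (at x)"
      by (rule derivative_eq_intros refl du[OF x] ux)+ (auto simp: g_def)
    show "(g has_derivative H x) (at x)"
      unfolding g_def[abs_def]
      by (rule derivative_eq_intros refl du[OF x] dG[OF x] un[OF x])+
        (auto simp: H_def algebra_simps power2_eq_square)
    have "(\<Sum>i\<in>Basis. G x i \<bullet> i) = laplacian u x"
      unfolding laplacian_def
      by (rule sum.cong) (auto simp: G_def inner_sum_left inner_Basis gradient_inner_Basis if_distrib cong: if_cong)
    then have "laplacian u x = (\<Sum>i\<in>Basis. G x i \<bullet> i)" by simp
    then have "(\<Sum>i\<in>Basis. H x i \<bullet> i) = inverse (u x) * laplacian u x
        - inverse (u x)^2 * (\<Sum>i\<in>Basis. (gradient u x \<bullet> i) * (gradient u x \<bullet> i))"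
      by (simp add: H_def inner_diff_left sum_subtractf sum_distrib_left mult_ac)
    also have "\<dots> = inverse (u x) * laplacian u x - (norm (g x))\<^sup>2"
      using ux by (simp add: euclidean_inner[symmetric] g_def power_mult_distrib power2_norm_eq_inner[symmetric])
    finally have 1: "(\<Sum>i\<in>Basis. H x i \<bullet> i) + (norm (g x))\<^sup>2 = inverse (u x) * laplacian u x" by simp
    have "inverse (u x) * laplacian u x \<le> inverse (u x) * (- lam * u x powr (- \<gamma>))"
      using ux le[OF x] by (intro mult_left_mono) auto
    also have "\<dots> = - lam * exp (- (1 + \<gamma>) * ln (u x))"
    proof -
      have "exp (- (1 + \<gamma>) * ln (u x)) = exp (- ln (u x)) * exp (- \<gamma> * ln (u x))"
        by (simp flip: exp_add add: algebra_simps)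
      also have "\<dots> = inverse (u x) * u x powr (- \<gamma>)"
        using ux by (simp add: exp_minus powr_def)
      finally show ?thesis by simp
    qed
    finally show "(\<Sum>i\<in>Basis. H x i \<bullet> i) + (norm (g x))\<^sup>2 + lam * exp (- (1 + \<gamma>) * ln (u x)) \<le> 0"
      using 1 by simp
  next
    show "continuous_on U (\<lambda>x. H x e)" for e
      unfolding H_def by (intro continuous_intros cG cgu cu) (auto simp: un)
  qed
qed

section \<open>Smooth test functions on the sphere\<close>

lemma tendsto_poly_exp_minus:
  fixes q :: "real poly"
  shows "((\<lambda>s. poly q s * exp (- s)) \<longlongrightarrow> 0) at_top"
proof -
  have "((\<lambda>s. \<Sum>i\<le>degree q. coeff q i * (s ^ i / exp s)) \<longlongrightarrow> (\<Sum>i\<le>degree q. coeff q i * 0)) at_top"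
    by (intro tendsto_intros tendsto_power_div_exp_0)
  then show ?thesis
    by (simp add: poly_altdef sum_distrib_left exp_minus divide_inverse mult_ac)
qed

text \<open>The recurrence is the derivative of \<open>q (1 / t) * exp (- (1 / t))\<close>: with s =
  1 / t, its polynomial factor is s^2 (q(s) - q'(s)).\<close>

fun flat_poly :: "nat \<Rightarrow> real poly" where
  "flat_poly 0 = 1"
| "flat_poly (Suc k) = [:0, 0, 1:] * (flat_poly k - pderiv (flat_poly k))"

text \<open>The \<open>k\<close>-th derivative of the flat function \<open>t \<mapsto> exp (- 1 / t)\<close>, extended by \<open>0\<close> to \<open>t \<le> 0\<close>.\<close>

definition flat_deriv :: "nat \<Rightarrow> real \<Rightarrow> real" where
  "flat_deriv k t = (if t > 0 then poly (flat_poly k) (1 / t) * exp (- (1 / t)) else 0)"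

lemma DERIV_flat_deriv: "DERIV (flat_deriv k) t :> flat_deriv (Suc k) t"
proof -
  consider "t > 0" | "t < 0" | "t = 0" by linarith
  then show ?thesis
  proof cases
    case 1
    have "((\<lambda>t. poly (flat_poly k) (1 / t) * exp (- (1 / t))) has_real_derivative flat_deriv (Suc k) t) (at t)"
      using 1 by (auto intro!: derivative_eq_intros DERIV_chain2[OF poly_DERIV]
          simp: flat_deriv_def field_simps power2_eq_square)
    then show ?thesis
      by (rule has_field_derivative_transform_within_open[of _ _ _ "{0<..}"])
        (use 1 in \<open>auto simp: flat_deriv_def\<close>)
  next
    case 2
    have "((\<lambda>_. 0) has_real_derivative flat_deriv (Suc k) t) (at t)"
      using 2 by (simp add: flat_deriv_def)
    then show ?thesis
      by (rule has_field_derivative_transform_within_open[of _ _ _ "{..<0}"])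
        (use 2 in \<open>auto simp: flat_deriv_def\<close>)
  next
    case 3
    have r: "((\<lambda>h. flat_deriv k h / h) \<longlongrightarrow> 0) (at_right 0)"
    proof -
      \<comment> \<open>The additional factor \<open>[:0, 1:]\<close> stands for the division by
        \<open>h\<close> in the difference quotient.\<close>
      have "((\<lambda>h. poly (flat_poly k * [:0, 1:]) (inverse h) * exp (- inverse h)) \<longlongrightarrow> 0) (at_right 0)"
        by (rule filterlim_compose[OF tendsto_poly_exp_minus filterlim_inverse_at_top_right])
      then show ?thesis
        by (rule Lim_transform_eventually)
          (auto simp: eventually_at_right_field flat_deriv_def divide_inverse intro!: exI[of _ 1])
    qed
    have l: "((\<lambda>h. flat_deriv k h / h) \<longlongrightarrow> 0) (at_left 0)"
      by (rule tendsto_eventually) (auto simp: eventually_at_left_field flat_deriv_def intro!: exI[of _ "-1"])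
    have "((\<lambda>h. flat_deriv k h / h) \<longlongrightarrow> 0) (at 0)"
      using l r by (simp add: filterlim_at_split)
    then show ?thesis using 3 by (simp add: DERIV_def flat_deriv_def)
  qed
qed

text \<open>The functions \<open>C * flat_deriv j (a \<bullet> x - c)\<close> form a family closed
  under partial derivatives, which multiply \<open>C\<close> by \<open>a \<bullet> i\<close> and
  raise \<open>j\<close>; the induction therefore runs over all \<open>C\<close> and
  \<open>j\<close> together.\<close>

lemma Cinf_on_flat_ridge:
  fixes a :: "'a::euclidean_space"
  shows "Cinf_on U (\<lambda>x. flat_deriv 0 (a \<bullet> x - c))"
proof -
  have d: "((\<lambda>x. C * flat_deriv j (a \<bullet> x - c)) has_derivative
      (\<lambda>h. C * (a \<bullet> h) * flat_deriv (Suc j) (a \<bullet> x - c))) (at x)" for C j x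
  proof -
    have "((\<lambda>x. a \<bullet> x - c) has_derivative (\<lambda>h. a \<bullet> h)) (at x)"
      by (auto intro!: derivative_eq_intros)
    from has_derivative_compose[OF this DERIV_flat_deriv[unfolded has_field_derivative_def]]
    show ?thesis by (auto intro!: derivative_eq_intros simp: mult_ac)
  qed
  have "Ck_on k U (\<lambda>x. C * flat_deriv j (a \<bullet> x - c))" for k C j
  proof (induction k arbitrary: C j)
    case 0
    show ?case unfolding Ck_on.simps
      by (rule has_derivative_continuous_on, rule has_derivative_at_withinI, rule d)
  next
    case (Suc k)
    have "partial_deriv i (\<lambda>x. C * flat_deriv j (a \<bullet> x - c)) =
        (\<lambda>x. (C * (a \<bullet> i)) * flat_deriv (Suc j) (a \<bullet> x - c))" for i
      unfolding partial_deriv_def by (rule ext) (simp add: frechet_derivative_at[OF d, symmetric])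
    moreover have "(\<lambda>x. C * flat_deriv j (a \<bullet> x - c)) differentiable (at x)" for x
      unfolding differentiable_def using d by blast
    ultimately show ?case using Suc by simp
  qed
  from this[of _ 1] show ?thesis by (simp add: Cinf_on_def)
qed

text \<open>The infimum that defines the eigenvalue ranges over a nonempty set. On the sphere a flat
  ridge in the direction \<open>a\<close> lives on a cap around \<open>a\<close>.\<close>

lemma Cinf_compact_support_exists:
  fixes \<Sigma> :: "'a::euclidean_space set"
  assumes \<Sigma>: "openin (top_of_set (sphere 0 1)) \<Sigma>" and ne: "\<Sigma> \<noteq> {}"
  shows "\<exists>F. Cinf_compact_support \<Sigma> F \<and> (\<exists>\<theta>\<in>\<Sigma>. F \<theta> \<noteq> 0)"
proof -
  obtain a where a: "a \<in> \<Sigma>" using ne by blast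
  obtain T where T: "open T" "\<Sigma> = sphere 0 1 \<inter> T" using \<Sigma> by (auto simp: openin_open)
  obtain r where r: "r > 0" "ball a r \<subseteq> T" using T a open_contains_ball by blast
  have na: "norm a = 1" using a T by auto
  have r2: "r\<^sup>2 > 0" using r(1) by (rule zero_less_power)
  \<comment> \<open>On the cap \<open>c \<le> a \<bullet> x\<close> the squared distance to
    \<open>a\<close> is \<open>2 - 2 * (a \<bullet> x) \<le> r\<^sup>2 / 4\<close>, so the cap stays
    in the ball; \<open>c < 1\<close> makes \<open>F a\<close> positive.\<close>
  define c where "c = 1 - r\<^sup>2 / 8"
  define F where "F x = flat_deriv 0 (a \<bullet> x - c)" for x
  define K where "K = sphere 0 1 \<inter> {x. c \<le> a \<bullet> x}"
  have "compact K" unfolding K_def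
    by (intro compact_Int_closed compact_sphere closed_Collect_le continuous_intros)
  moreover have "K \<subseteq> \<Sigma>"
  proof
    fix x assume x: "x \<in> K"
    then have nx: "norm x = 1" "c \<le> a \<bullet> x" by (auto simp: K_def)
    have "(norm (a - x))\<^sup>2 = 2 - 2 * (a \<bullet> x)"
      using na nx by (simp add: power2_norm_eq_inner inner_diff_left inner_diff_right inner_commute norm_eq_1)
    also have "\<dots> < r\<^sup>2" using nx(2) r2 unfolding c_def by linarith
    finally have "norm (a - x) < r" using r(1) power_less_imp_less_base by fastforce
    then show "x \<in> \<Sigma>" using r T x by (auto simp: K_def dist_norm)
  qed
  moreover have "F x = 0" if "x \<in> \<Sigma> - K" for x
    using that T by (auto simp: K_def F_def flat_deriv_def)
  moreover have "smooth_on_sphere \<Sigma> F"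
    unfolding smooth_on_sphere_def
    using Cinf_on_flat_ridge[of UNIV a c, folded F_def] by (auto intro!: exI[of _ UNIV] exI[of _ F])
  moreover have "F a \<noteq> 0"
    using na r(1) by (simp add: F_def flat_deriv_def c_def norm_eq_1)
  ultimately show ?thesis unfolding Cinf_compact_support_def using a by blast
qed

section \<open>Cones and extensions homogeneous of degree zero\<close>

lemma normalize_scaleR: "s > 0 \<Longrightarrow> (s *\<^sub>R x) /\<^sub>R norm (s *\<^sub>R x) = x /\<^sub>R norm (x :: 'a::real_normed_vector)"
  by simp

lemma normalize_unit: "norm x = 1 \<Longrightarrow> x /\<^sub>R norm x = (x :: 'a::real_normed_vector)"
  by simp

lemma Cone_scaleR: "x \<in> Cone \<Sigma> \<Longrightarrow> s > 0 \<Longrightarrow> s *\<^sub>R x \<in> Cone \<Sigma>"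
  using normalize_scaleR[of s x] unfolding Cone_def by (simp del: norm_scaleR)

lemma Cone_unit: "norm x = 1 \<Longrightarrow> x \<in> Cone \<Sigma> \<longleftrightarrow> x \<in> \<Sigma>"
  unfolding Cone_def by auto

lemma continuous_on_normalize:
  "0 \<notin> A \<Longrightarrow> continuous_on A (\<lambda>x. x /\<^sub>R norm x :: 'a::real_normed_vector)"
  by (intro continuous_intros) auto

lemma open_normalize_vimage:
  assumes "open T"
  shows "open {x::'a::real_normed_vector. x \<noteq> 0 \<and> x /\<^sub>R norm x \<in> T}"
proof -
  have "open ((- {0}) \<inter> (\<lambda>x::'a. x /\<^sub>R norm x) -` T)"
    by (intro continuous_open_preimage continuous_on_normalize assms) auto
  moreover have "{x::'a. x \<noteq> 0 \<and> x /\<^sub>R norm x \<in> T} = (- {0}) \<inter> (\<lambda>x. x /\<^sub>R norm x) -` T" by auto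
  ultimately show ?thesis by simp
qed

lemma open_Cone:
  fixes \<Sigma> :: "'a::euclidean_space set"
  assumes "openin (top_of_set (sphere 0 1)) \<Sigma>"
  shows "open (Cone \<Sigma>)"
proof -
  obtain T where T: "open T" "\<Sigma> = sphere 0 1 \<inter> T" using assms by (auto simp: openin_open)
  have "Cone \<Sigma> = {x. x \<noteq> 0 \<and> x /\<^sub>R norm x \<in> T}" by (auto simp: Cone_def T(2))
  with open_normalize_vimage[OF T(1)] show ?thesis by (simp only:)
qed

lemma has_derivative_normalize:
  fixes x :: "'a::euclidean_space"
  assumes "x \<noteq> 0"
  shows "((\<lambda>x. x /\<^sub>R norm x) has_derivative
      (\<lambda>h. h /\<^sub>R norm x - ((x \<bullet> h) * inverse (norm x) ^ 3) *\<^sub>R x)) (at x)"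
proof -
  have n: "(norm has_derivative (\<lambda>h. h \<bullet> sgn x)) (at x)"
    by (rule has_derivative_norm[OF assms])
  have "norm x \<noteq> 0" using assms by simp
  from has_derivative_scaleR[OF Deriv.has_derivative_inverse[OF this n] has_derivative_ident]
  have "((\<lambda>x. x /\<^sub>R norm x) has_derivative (\<lambda>h. inverse (norm x) *\<^sub>R h
      + - (inverse (norm x) * (h \<bullet> sgn x) * inverse (norm x)) *\<^sub>R x)) (at x)" .
  also have "(\<lambda>h. inverse (norm x) *\<^sub>R h + - (inverse (norm x) * (h \<bullet> sgn x) * inverse (norm x)) *\<^sub>R x)
      = (\<lambda>h. h /\<^sub>R norm x - ((x \<bullet> h) * inverse (norm x) ^ 3) *\<^sub>R x)"
    by (rule ext) (simp add: sgn_div_norm power3_eq_cube inner_commute[of _ x])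
  finally show ?thesis .
qed

definition tangential_gradient :: "('a::euclidean_space \<Rightarrow> real) \<Rightarrow> 'a \<Rightarrow> 'a" where
  "tangential_gradient G \<theta> = gradient G \<theta> - (gradient G \<theta> \<bullet> \<theta>) *\<^sub>R \<theta>"

text \<open>The derivative of the normalisation is \<open>1 / norm x\<close> times the projection
  orthogonal to \<open>x\<close>, so the radial part of the gradient of \<open>G\<close> is
  lost.\<close>

lemma has_derivative_radial_extension:
  fixes G :: "'a::euclidean_space \<Rightarrow> real"
  assumes x: "x \<noteq> 0" and G: "(G has_derivative (\<lambda>h. gradient G (x /\<^sub>R norm x) \<bullet> h)) (at (x /\<^sub>R norm x))"
  shows "((\<lambda>x. G (x /\<^sub>R norm x)) has_derivative
      (\<lambda>h. (tangential_gradient G (x /\<^sub>R norm x) /\<^sub>R norm x) \<bullet> h)) (at x)"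
proof -
  have "((\<lambda>x. G (x /\<^sub>R norm x)) has_derivative
      (\<lambda>h. gradient G (x /\<^sub>R norm x) \<bullet> (h /\<^sub>R norm x - ((x \<bullet> h) * inverse (norm x) ^ 3) *\<^sub>R x))) (at x)"
    by (rule has_derivative_compose[OF has_derivative_normalize[OF x] G])
  also have "(\<lambda>h. gradient G (x /\<^sub>R norm x) \<bullet> (h /\<^sub>R norm x - ((x \<bullet> h) * inverse (norm x) ^ 3) *\<^sub>R x))
      = (\<lambda>h. (tangential_gradient G (x /\<^sub>R norm x) /\<^sub>R norm x) \<bullet> h)"
    by (rule ext) (simp add: tangential_gradient_def inner_diff_left inner_diff_right power3_eq_cube algebra_simps)
  finally show ?thesis .
qed

text \<open>Calculus on the sphere becomes calculus in an open set. The smooth extensions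
  \<open>G\<close> are only local and may disagree off the sphere, but \<open>E\<close> is one
  function, so its gradient \<open>dF\<close> is defined on the whole cone and each \<open>G\<close>
  merely serves to compute it nearby.\<close>

lemma radial_extension:
  fixes \<Sigma> :: "'a::euclidean_space set"
  assumes \<Sigma>: "openin (top_of_set (sphere 0 1)) \<Sigma>" and F: "Cinf_compact_support \<Sigma> F"
  defines "E \<equiv> \<lambda>x. F (x /\<^sub>R norm x)"
  obtains K dF where "compact K" "K \<subseteq> \<Sigma>"
    "\<And>x. x \<in> Cone \<Sigma> \<Longrightarrow> (E has_derivative (\<lambda>h. dF x \<bullet> h)) (at x)"
    "continuous_on (Cone \<Sigma>) dF"
    "\<And>x. x \<in> Cone \<Sigma> \<Longrightarrow> dF x \<bullet> x = 0"
    "\<And>x. x \<in> Cone \<Sigma> \<Longrightarrow> sphere_grad \<Sigma> F (x /\<^sub>R norm x) = norm x *\<^sub>R dF x"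
    "\<And>x. x \<in> Cone \<Sigma> \<Longrightarrow> x /\<^sub>R norm x \<notin> K \<Longrightarrow> E x = 0 \<and> dF x = 0"
proof -
  obtain K where K: "compact K" "K \<subseteq> \<Sigma>" "\<And>\<theta>. \<theta> \<in> \<Sigma> - K \<Longrightarrow> F \<theta> = 0"
    and smooth: "smooth_on_sphere \<Sigma> F"
    using F by (auto simp: Cinf_compact_support_def)
  \<comment> \<open>\<open>V\<close> contains both \<open>x\<close> and its projection, so the two
    gradients come from the same \<open>G\<close> and can be compared.\<close>
  have loc: "\<exists>V G. open V \<and> x \<in> V \<and> V \<subseteq> Cone \<Sigma> \<and> x /\<^sub>R norm x \<in> V \<and>
      (\<forall>y\<in>V. (E has_derivative (\<lambda>h. (tangential_gradient G (y /\<^sub>R norm y) /\<^sub>R norm y) \<bullet> h)) (at y)) \<and>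
      continuous_on V (\<lambda>y. tangential_gradient G (y /\<^sub>R norm y) /\<^sub>R norm y)" if x: "x \<in> Cone \<Sigma>" for x
  proof -
    have "x /\<^sub>R norm x \<in> \<Sigma>" using x by (simp add: Cone_def)
    then obtain U G where U: "open U" "x /\<^sub>R norm x \<in> U" "Cinf_on U G" "\<And>\<omega>. \<omega> \<in> U \<inter> \<Sigma> \<Longrightarrow> F \<omega> = G \<omega>"
      using smooth unfolding smooth_on_sphere_def by meson
    have C1: "Ck_on (Suc 0) U G" using U(3) by (simp only: Cinf_on_def)
    define V where "V = Cone \<Sigma> \<inter> {y. y \<noteq> 0 \<and> y /\<^sub>R norm y \<in> U}"
    have V: "open V" unfolding V_def by (intro open_Int open_Cone \<Sigma> open_normalize_vimage U)
    have x0: "x \<noteq> 0" using x by (simp add: Cone_def)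
    have xV: "x \<in> V" "x /\<^sub>R norm x \<in> V"
      using x x0 U(2) unfolding V_def Cone_def by auto
    have "(E has_derivative (\<lambda>h. (tangential_gradient G (y /\<^sub>R norm y) /\<^sub>R norm y) \<bullet> h)) (at y)"
      if y: "y \<in> V" for y
    proof (rule has_derivative_transform_within_open[OF _ V y])
      show "((\<lambda>x. G (x /\<^sub>R norm x)) has_derivative
          (\<lambda>h. (tangential_gradient G (y /\<^sub>R norm y) /\<^sub>R norm y) \<bullet> h)) (at y)"
        by (rule has_derivative_radial_extension) (use y Ck_on_1_D(1)[OF C1] in \<open>auto simp: V_def\<close>)
      show "G (z /\<^sub>R norm z) = E z" if "z \<in> V" for z
        using that U(4) by (auto simp: V_def E_def Cone_def)
    qed
    moreover have "continuous_on V (\<lambda>y. tangential_gradient G (y /\<^sub>R norm y) /\<^sub>R norm y)"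
    proof -
      have n: "continuous_on V (\<lambda>y. y /\<^sub>R norm y)" by (rule continuous_on_normalize) (simp add: V_def)
      have "continuous_on V (\<lambda>y. gradient G (y /\<^sub>R norm y))"
        by (rule continuous_on_compose2[OF Ck_on_1_D(2)[OF C1] n]) (auto simp: V_def)
      then show ?thesis unfolding tangential_gradient_def
        by (intro continuous_on_scaleR continuous_on_diff continuous_on_inner continuous_on_inverse
            continuous_on_norm_id n) (auto simp: V_def)
    qed
    ultimately show ?thesis using V xV by (intro exI[of _ V] exI[of _ G]) (auto simp: V_def)
  qed
  define dF where "dF = gradient E"
  have d: "(E has_derivative (\<lambda>h. dF x \<bullet> h)) (at x)" if "x \<in> Cone \<Sigma>" for x
  proof -
    have "E differentiable (at x)" using loc[OF that] unfolding differentiable_def by blast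
    then show ?thesis unfolding dF_def by (rule has_derivative_gradient)
  qed
  have T: "dF y = a" if "(E has_derivative (\<lambda>h. a \<bullet> h)) (at y)" for a y
    unfolding dF_def by (rule gradient_eqI[OF that])
  have props: "continuous (at x) dF \<and> dF x \<bullet> x = 0 \<and> dF (x /\<^sub>R norm x) = norm x *\<^sub>R dF x"
    if x: "x \<in> Cone \<Sigma>" for x
  proof -
    obtain V G where V: "open V" "x \<in> V" "V \<subseteq> Cone \<Sigma>" "x /\<^sub>R norm x \<in> V"
      "\<And>y. y \<in> V \<Longrightarrow> (E has_derivative (\<lambda>h. (tangential_gradient G (y /\<^sub>R norm y) /\<^sub>R norm y) \<bullet> h)) (at y)"
      "continuous_on V (\<lambda>y. tangential_gradient G (y /\<^sub>R norm y) /\<^sub>R norm y)"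
      using loc[OF x] by blast
    have x0: "x \<noteq> 0" using x by (simp add: Cone_def)
    have eq: "dF y = tangential_gradient G (y /\<^sub>R norm y) /\<^sub>R norm y" if "y \<in> V" for y
      by (rule T[OF V(5)[OF that]])
    have "continuous_on V dF"
      by (rule continuous_on_cong[THEN iffD2, OF refl _ V(6)]) (rule eq)
    then have "continuous (at x) dF" using V(1,2) by (simp add: continuous_on_eq_continuous_at)
    moreover have "dF x \<bullet> x = 0"
    proof -
      have "x \<bullet> x = norm x * norm x" by (simp add: power2_norm_eq_inner[symmetric] power2_eq_square)
      then show ?thesis using x0
        by (simp add: eq[OF V(2)] tangential_gradient_def inner_diff_left field_simps)
    qed
    moreover have "dF (x /\<^sub>R norm x) = norm x *\<^sub>R dF x"
      using x0 by (simp add: eq[OF V(2)] eq[OF V(4)])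
    ultimately show ?thesis by blast
  qed
  show thesis
  proof (rule that[of K dF])
    show "continuous_on (Cone \<Sigma>) dF"
      by (rule continuous_at_imp_continuous_on) (use props in blast)
    show "compact K" "K \<subseteq> \<Sigma>" by (rule K)+
    show "(E has_derivative (\<lambda>h. dF x \<bullet> h)) (at x)" if "x \<in> Cone \<Sigma>" for x by (rule d[OF that])
    show "dF x \<bullet> x = 0" if "x \<in> Cone \<Sigma>" for x using props[OF that] by blast
    fix x assume x: "x \<in> Cone \<Sigma>"
    let ?t = "x /\<^sub>R norm x"
    have x0: "x \<noteq> 0" and t: "?t \<in> \<Sigma>" using x by (auto simp: Cone_def)
    have nt: "norm ?t = 1" using x0 by simp
    have tC: "?t \<in> Cone \<Sigma>" using Cone_unit[OF nt] t by blast
    have "dF ?t \<bullet> ?t = 0" using props[OF tC] by blast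
    moreover have "(F has_derivative (\<lambda>h. dF ?t \<bullet> h)) (at ?t within \<Sigma>)"
    proof (rule has_derivative_transform[OF t _ has_derivative_at_withinI[OF d[OF tC]]])
      show "F y = E y" if "y \<in> \<Sigma>" for y
        using openin_imp_subset[OF \<Sigma>] that by (auto simp: E_def)
    qed
    ultimately have "sphere_grad \<Sigma> F ?t = dF ?t" by (rule sphere_grad_eqI[OF \<Sigma> t])
    then show "sphere_grad \<Sigma> F ?t = norm x *\<^sub>R dF x" using props[OF x] by simp
    assume tK: "?t \<notin> K"
    \<comment> \<open>\<open>dF x = 0\<close> requires \<open>E\<close> to vanish on a whole
      neighbourhood of \<open>x\<close>; the complement of \<open>K\<close> is open.\<close>
    define V where "V = Cone \<Sigma> \<inter> {y. y \<noteq> 0 \<and> y /\<^sub>R norm y \<in> - K}"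
    have V: "open V" unfolding V_def
      by (intro open_Int open_Cone \<Sigma> open_normalize_vimage open_Compl compact_imp_closed K)
    have xV: "x \<in> V" using x x0 tK by (simp add: V_def)
    have E0: "E y = 0" if "y \<in> V" for y using that K(3) by (auto simp: V_def E_def Cone_def)
    have "((\<lambda>_. 0) has_derivative (\<lambda>h. (0::'a) \<bullet> h)) (at x)" by simp
    then have "(E has_derivative (\<lambda>h. (0::'a) \<bullet> h)) (at x)"
      by (rule has_derivative_transform_within_open[OF _ V xV]) (simp add: E0)
    from T[OF this] show "E x = 0 \<and> dF x = 0" using E0[OF xV] by simp
  qed
qed

section \<open>Spherical integrals as limits of shell integrals\<close>

text \<open>The scaling is a constant density and the image measure a substitution, which leaves a
  volume integral of a function constant along rays.\<close>

lemma integral_sphere_measure: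
  fixes q :: "'a::euclidean_space \<Rightarrow> real"
  assumes q: "q \<in> borel_measurable borel"
  shows "integral\<^sup>L sphere_measure q =
    real DIM('a) * (LINT x|lborel. indicator (ball 0 1 - {0}) x * q (x /\<^sub>R norm x))"
proof -
  let ?B = "ball 0 1 - {0} :: 'a set"
  let ?D = "distr (restrict_space lborel ?B) borel (\<lambda>x::'a. x /\<^sub>R norm x)"
  have m: "(\<lambda>x::'a. x /\<^sub>R norm x) \<in> borel_measurable (restrict_space lborel ?B)"
    by (intro borel_measurable_scaleR borel_measurable_inverse borel_measurable_norm measurable_restrict_space1) auto
  have "scale_measure (of_nat DIM('a)) ?D = density ?D (\<lambda>_. of_nat DIM('a))"
    by (rule measure_eqI) (auto simp: emeasure_density nn_integral_cmult_indicator)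
  then have "integral\<^sup>L sphere_measure q = integral\<^sup>L (density ?D (\<lambda>_. ennreal (real DIM('a)))) q"
    unfolding sphere_measure_def by (simp only: ennreal_of_nat_eq_real_of_nat)
  also have "\<dots> = (LINT x|?D. real DIM('a) *\<^sub>R q x)"
    by (rule integral_density) (use q in auto)
  also have "\<dots> = real DIM('a) * integral\<^sup>L ?D q" by simp
  also have "integral\<^sup>L ?D q = (LINT x|restrict_space lborel ?B. q (x /\<^sub>R norm x))"
    by (rule integral_distr[OF m q])
  also have "\<dots> = (LINT x|lborel. indicator ?B x * q (x /\<^sub>R norm x))"
    by (subst integral_restrict_space) auto
  finally show ?thesis .
qed

text \<open>Squaring smooths the corner: at \<open>0\<close> the difference quotient is at most
  \<bar>h\<bar>.\<close>

lemma DERIV_positive_part_square: "DERIV (\<lambda>y::real. (max 0 y)\<^sup>2) y :> 2 * max 0 y"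
proof -
  consider "y > 0" | "y < 0" | "y = 0" by linarith
  then show ?thesis
  proof cases
    case 1
    have "((\<lambda>y. y\<^sup>2) has_real_derivative 2 * max 0 y) (at y)"
      using 1 by (auto intro!: derivative_eq_intros)
    then show ?thesis
      by (rule has_field_derivative_transform_within_open[of _ _ _ "{0<..}"]) (use 1 in auto)
  next
    case 2
    have "((\<lambda>_. 0) has_real_derivative 2 * max 0 y) (at y)" using 2 by simp
    then show ?thesis
      by (rule has_field_derivative_transform_within_open[of _ _ _ "{..<0}"]) (use 2 in auto)
  next
    case 3
    have "((\<lambda>h::real. (max 0 h)\<^sup>2 / h) \<longlongrightarrow> 0) (at 0)"
    proof (rule Lim_null_comparison)
      have "norm ((max 0 h)\<^sup>2 / h) \<le> \<bar>h\<bar>" for h :: real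
        by (cases "h > 0") (auto simp: power2_eq_square max_def)
      then show "\<forall>\<^sub>F h in at 0. norm ((max 0 h)\<^sup>2 / h) \<le> \<bar>h\<bar>" by simp
      show "((\<lambda>h::real. \<bar>h\<bar>) \<longlongrightarrow> 0) (at 0)" by (rule tendsto_eq_intros | simp)+
    qed
    then show ?thesis using 3 by (simp add: DERIV_def)
  qed
qed

text \<open>Meant for \<open>s = x \<bullet> x\<close>, so 1/4 and 1 are the squared radii of the
  shell. A squared positive part is C^1, which suffices for one integration by parts.\<close>

definition shell_bump :: "real \<Rightarrow> real" where
  "shell_bump s = (max 0 ((1 - s) * (s - 1/4)))\<^sup>2"

text \<open>Radial \<open>C\<^sup>1\<close> weights increasing to the indicator of the shell \<open>1/2 < norm x < 1\<close>.\<close>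

definition shell_weight :: "nat \<Rightarrow> 'a::euclidean_space \<Rightarrow> real" where
  "shell_weight k x = real (Suc k) * shell_bump (x \<bullet> x) / (1 + real (Suc k) * shell_bump (x \<bullet> x))"

lemma shell_bump_nonneg: "shell_bump s \<ge> 0"
  by (simp add: shell_bump_def)

lemma shell_bump_pos_iff: "shell_bump s > 0 \<longleftrightarrow> 1/4 < s \<and> s < 1"
proof -
  have "(max 0 y)\<^sup>2 > 0 \<longleftrightarrow> y > 0" for y :: real by (auto simp: max_def)
  then have "shell_bump s > 0 \<longleftrightarrow> (1 - s) * (s - 1/4) > 0" unfolding shell_bump_def .
  also have "\<dots> \<longleftrightarrow> 1/4 < s \<and> s < 1" by (auto simp: zero_less_mult_iff)
  finally show ?thesis .
qed

lemma inner_self_shell_iff: "1/4 < x \<bullet> x \<and> x \<bullet> x < 1 \<longleftrightarrow> 1/2 < norm x \<and> norm (x::'a::real_inner) < 1"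
proof -
  have "x \<bullet> x = (norm x)\<^sup>2" by (simp add: power2_norm_eq_inner)
  moreover have "1/4 < (norm x)\<^sup>2 \<longleftrightarrow> 1/2 < norm x"
    using power_strict_mono[of "1/2" "norm x" 2] power2_less_imp_less[of "1/2" "norm x"]
    by (auto simp: power2_eq_square)
  moreover have "(norm x)\<^sup>2 < 1 \<longleftrightarrow> norm x < 1"
    using abs_square_less_1[of "norm x"] by simp
  ultimately show ?thesis by simp
qed

lemma shell_weight_bounds: "0 \<le> shell_weight k x" "shell_weight k x \<le> 1"
proof -
  have "0 \<le> real (Suc k) * shell_bump (x \<bullet> x)"
    by (intro mult_nonneg_nonneg shell_bump_nonneg) simp
  then have "0 \<le> y / (1 + y) \<and> y / (1 + y) \<le> 1" if "y = real (Suc k) * shell_bump (x \<bullet> x)" for y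
    using that by (auto simp: divide_simps)
  then show "0 \<le> shell_weight k x" "shell_weight k x \<le> 1" unfolding shell_weight_def by blast+
qed

lemma shell_weight_eq_0: "\<not> (1/2 < norm x \<and> norm x < 1) \<Longrightarrow> shell_weight k x = 0"
  using shell_bump_pos_iff[of "x \<bullet> x"] shell_bump_nonneg[of "x \<bullet> x"] inner_self_shell_iff[of x]
  by (auto simp: shell_weight_def)

lemma shell_weight_pos: "1/2 < norm x \<Longrightarrow> norm x < 1 \<Longrightarrow> shell_weight k x > 0"
  using shell_bump_pos_iff[of "x \<bullet> x"] inner_self_shell_iff[of x]
  by (auto simp: shell_weight_def add_pos_pos intro!: divide_pos_pos)

text \<open>The gradient of a function of \<open>x \<bullet> x\<close> is parallel to
  \<open>x\<close>, the property by which tangential fields do not see the weight.\<close>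

lemma shell_weight_C1:
  fixes k :: nat
  obtains r :: "'a::euclidean_space \<Rightarrow> real" where
    "\<And>x. (shell_weight k has_derivative (\<lambda>h. r x * (x \<bullet> h))) (at x)" "continuous_on UNIV r"
proof
  define J where "J = real (Suc k)"
  define b' where "b' s = 2 * max 0 ((1 - s) * (s - 1/4)) * (5/4 - 2 * s)" for s :: real
  define r where "r x = 2 * (J * b' (x \<bullet> x) / (1 + J * shell_bump (x \<bullet> x))\<^sup>2)" for x :: 'a
  have nz: "1 + J * shell_bump s \<noteq> 0" for s
    using shell_bump_nonneg[of s] by (smt (verit) J_def mult_nonneg_nonneg of_nat_0_le_iff)
  have db: "DERIV shell_bump s :> b' s" for s
  proof -
    have "((\<lambda>s. (1 - s) * (s - 1/4)) has_real_derivative 5/4 - 2 * s) (at s)"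
      by (auto intro!: derivative_eq_intros)
    from DERIV_chain2[OF DERIV_positive_part_square this]
    show ?thesis unfolding shell_bump_def[abs_def] b'_def .
  qed
  have dJ: "DERIV (\<lambda>s. J * shell_bump s / (1 + J * shell_bump s)) s :> J * b' s / (1 + J * shell_bump s)\<^sup>2" for s
  proof -
    have "DERIV (\<lambda>s. J * shell_bump s / (1 + J * shell_bump s)) s :>
      ((J * b' s) * (1 + J * shell_bump s) - (J * shell_bump s) * (J * b' s)) / ((1 + J * shell_bump s) * (1 + J * shell_bump s))"
      by (auto intro!: derivative_eq_intros db simp: nz)
    then show ?thesis by (simp add: power2_eq_square algebra_simps)
  qed
  show "(shell_weight k has_derivative (\<lambda>h. r x * (x \<bullet> h))) (at x)" for x :: 'a
  proof -
    have "((\<lambda>x. x \<bullet> x) has_derivative (\<lambda>h. 2 * (x \<bullet> h))) (at x)"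
      by (auto intro!: derivative_eq_intros simp: inner_commute)
    from has_derivative_compose[OF this dJ[unfolded has_field_derivative_def]]
    show ?thesis unfolding shell_weight_def[abs_def] J_def[symmetric] r_def by (simp add: mult_ac)
  qed
  have "continuous_on UNIV (\<lambda>x::'a. shell_bump (x \<bullet> x))"
    unfolding shell_bump_def by (intro continuous_intros)
  then show "continuous_on UNIV r"
    unfolding r_def[abs_def] b'_def using nz by (auto intro!: continuous_intros)
qed

lemma integral_ball_homogeneous:
  fixes Q :: "'a::euclidean_space \<Rightarrow> real"
  assumes "Q \<in> borel_measurable borel" "\<And>s x. s > 0 \<Longrightarrow> Q (s *\<^sub>R x) = Q x" and R: "R > 0"
  shows "(LINT x|lborel. indicator (ball 0 R) x * Q x) = R ^ DIM('a) * (LINT x|lborel. indicator (ball 0 1) x * Q x)"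
proof -
  have ind: "indicator (ball 0 R) (R *\<^sub>R x) = (indicator (ball 0 1) x :: real)" for x :: 'a
    using R by (auto simp: indicator_def)
  let ?D = "distr lborel borel (\<lambda>x::'a. 0 + R *\<^sub>R x)"
  have m: "(\<lambda>x. indicator (ball 0 R) x * Q x) \<in> borel_measurable borel" by (intro borel_measurable_times borel_measurable_indicator assms(1)) auto
  have "(LINT x|lborel. indicator (ball 0 R) x * Q x) =
      integral\<^sup>L (density ?D (\<lambda>_. ennreal (R ^ DIM('a)))) (\<lambda>x. indicator (ball 0 R) x * Q x)"
    using R by (subst lborel_affine[of R 0]) (simp_all add: ennreal_power)
  also have "\<dots> = (LINT x|?D. R ^ DIM('a) *\<^sub>R (indicator (ball 0 R) x * Q x))"
    by (rule integral_density) (use R m in auto)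
  also have "\<dots> = R ^ DIM('a) * (LINT x|?D. indicator (ball 0 R) x * Q x)" by simp
  also have "(LINT x|?D. indicator (ball 0 R) x * Q x) = (LINT x|lborel. indicator (ball 0 R) (0 + R *\<^sub>R x) * Q (0 + R *\<^sub>R x))"
    by (rule integral_distr) (use m in auto)
  finally show ?thesis using ind assms(2)[OF R] by simp
qed

text \<open>Dominated convergence gives the integral over the unit ball minus that over the ball of
  radius 1/2. Since \<open>Q\<close> is constant along rays, the latter is
  \<open>(1/2) ^ DIM('a)\<close> times the former.\<close>

lemma integral_shell_weight_tendsto:
  fixes Q :: "'a::euclidean_space \<Rightarrow> real"
  assumes Q: "Q \<in> borel_measurable borel" "\<And>s x. s > 0 \<Longrightarrow> Q (s *\<^sub>R x) = Q x" "\<And>x. \<bar>Q x\<bar> \<le> B"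
  shows "(\<lambda>k. LINT x|lborel. shell_weight k x * Q x) \<longlonglongrightarrow>
    (1 - (1/2) ^ DIM('a)) * (LINT x|lborel. indicator (ball 0 1 - {0}) x * Q x)"
proof -
  define f where "f x = indicator (ball 0 1) x * Q x - indicator (ball 0 (1/2)) x * Q x" for x
  have m: "(\<lambda>x. indicator A x * Q x) \<in> borel_measurable borel" if "A \<in> sets borel" for A
    by (intro borel_measurable_times borel_measurable_indicator Q(1) that)
  have i: "integrable lborel (\<lambda>x. indicator (ball 0 R) x * Q x)" for R
  proof (rule Bochner_Integration.integrable_bound)
    show "integrable lborel (\<lambda>x::'a. B * indicator (ball 0 R) x)"
      using emeasure_bounded_finite[OF bounded_ball]
      by (intro integrable_mult_right integrable_real_indicator) auto
    show "AE x in lborel. norm (indicator (ball 0 R) x * Q x) \<le> norm (B * indicator (ball 0 R) x)"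
      using Q(3) by (auto simp: indicator_def intro: order_trans[OF _ abs_ge_self])
  qed (use m in auto)
  have null: "sphere (0::'a) c \<in> null_sets lborel" for c
    using negligible_sphere[of "0::'a" c] by (simp add: negligible_iff_null_sets null_sets_completion_iff)
  have "(\<lambda>k. LINT x|lborel. shell_weight k x * Q x) \<longlonglongrightarrow> (LINT x|lborel. f x)"
  proof (rule integral_dominated_convergence)
    show "f \<in> borel_measurable lborel" unfolding f_def using m by auto
    show "(\<lambda>x. shell_weight k x * Q x) \<in> borel_measurable lborel" for k
    proof -
      obtain r :: "'a \<Rightarrow> real" where r: "\<And>x. (shell_weight k has_derivative (\<lambda>h. r x * (x \<bullet> h))) (at x)"
        and "continuous_on UNIV r" by (rule shell_weight_C1[of k]) (rule that)
      have "continuous_on UNIV (shell_weight k :: 'a \<Rightarrow> real)"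
        by (rule has_derivative_continuous_on, rule has_derivative_at_withinI, rule r)
      then show ?thesis using borel_measurable_times[OF borel_measurable_continuous_onI Q(1)] by simp
    qed
    show "integrable lborel (\<lambda>x::'a. B * indicator (ball 0 1) x)"
      using emeasure_bounded_finite[OF bounded_ball]
      by (intro integrable_mult_right integrable_real_indicator) auto
    have "norm (shell_weight k x * Q x) \<le> B * indicator (ball 0 1) x" for k and x :: 'a
    proof (cases "norm x < 1")
      case True
      have "\<bar>shell_weight k x\<bar> * \<bar>Q x\<bar> \<le> 1 * B"
        using shell_weight_bounds[of k x] Q(3) by (intro mult_mono) auto
      then show ?thesis using True by (simp add: abs_mult)
    qed (use shell_weight_eq_0[of x k] in auto)
    then show "AE x in lborel. norm (shell_weight k x * Q x) \<le> B * indicator (ball 0 1) x" for k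
      by simp
    \<comment> \<open>On the sphere of radius 1/2 every weight is zero while
      \<open>f x = Q x\<close>; this sphere is a null set.\<close>
    have "(\<lambda>k. shell_weight k x * Q x) \<longlonglongrightarrow> f x" if "norm x \<noteq> 1/2" for x
    proof (cases "1/2 < norm x \<and> norm x < 1")
      case True
      then have b: "shell_bump (x \<bullet> x) > 0" using shell_bump_pos_iff inner_self_shell_iff by blast
      have "(\<lambda>k. real (Suc k) * b / (1 + real (Suc k) * b)) \<longlonglongrightarrow> 1" if "b > 0" for b :: real
      proof -
        have "(\<lambda>k. b / (inverse (real (Suc k)) + b)) \<longlonglongrightarrow> b / (0 + b)"
          by (intro tendsto_intros LIMSEQ_inverse_real_of_nat) (use that in auto)
        moreover have "b / (inverse (real (Suc k)) + b) = real (Suc k) * b / (1 + real (Suc k) * b)" for k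
        proof -
          have "inverse (real (Suc k)) + b = (1 + real (Suc k) * b) / real (Suc k)"
            by (simp add: field_simps)
          then show ?thesis by simp
        qed
        ultimately show ?thesis using that by simp
      qed
      then have "(\<lambda>k. shell_weight k x) \<longlonglongrightarrow> 1" using b unfolding shell_weight_def by blast
      then have "(\<lambda>k. shell_weight k x * Q x) \<longlonglongrightarrow> 1 * Q x" by (intro tendsto_intros)
      then show ?thesis using True by (simp add: f_def)
    next
      case False
      then show ?thesis using that shell_weight_eq_0[OF False] by (auto simp: f_def indicator_def)
    qed
    then show "AE x in lborel. (\<lambda>k. shell_weight k x * Q x) \<longlonglongrightarrow> f x"
      by (intro AE_I'[OF null[of "1/2"]]) (simp only: subset_iff mem_Collect_eq mem_sphere_0, blast)
  qed
  also have "(LINT x|lborel. f x) = (1 - (1/2) ^ DIM('a)) * (LINT x|lborel. indicator (ball 0 1) x * Q x)"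
    unfolding f_def using i integral_ball_homogeneous[OF Q(1,2), of "1/2"]
    by (simp add: left_diff_distrib)
  also have "(LINT x|lborel. indicator (ball 0 1) x * Q x) = (LINT x|lborel. indicator (ball 0 1 - {0}) x * Q x)"
  proof (rule integral_cong_AE)
    have "sphere (0::'a) 0 \<in> null_sets lborel" by (rule null)
    then show "AE x in lborel. indicator (ball 0 1) x * Q x = indicator (ball 0 1 - {0}) x * Q x"
      by (rule AE_I') (auto simp: indicator_def)
  qed (use m in auto)
  finally show ?thesis .
qed

text \<open>A nonnegative continuous function with zero integral over a box vanishes there. This
  makes the total weight of the mean positive.\<close>

lemma integral_pos_compact_support:
  fixes f :: "'a::euclidean_space \<Rightarrow> real"
  assumes S: "compact S" and f: "continuous_on UNIV f" "\<And>x. x \<notin> S \<Longrightarrow> f x = 0" "\<And>x. f x \<ge> 0" and y: "f y > 0"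
  shows "(LINT x|lborel. f x) > 0"
proof -
  have yS: "y \<in> S" using f(2)[of y] y by auto
  obtain a where a: "S \<subseteq> box (- a) a"
    using bounded_subset_box_symmetric[OF compact_imp_bounded[OF S]] by blast
  then have ac: "S \<subseteq> cbox (- a) a" using box_subset_cbox by blast
  have c: "continuous_on (cbox (- a) a) f" using f(1) continuous_on_subset by blast
  have eq: "(LINT x|lborel. f x) = integral (cbox (- a) a) f"
    by (rule integral_compact_support_cbox[OF S f(1,2) ac])
  have "(LINT x|lborel. f x) \<ge> 0" using f(3) by (intro integral_nonneg_AE) auto
  moreover have "integral (cbox (- a) a) f \<noteq> 0"
  proof
    assume "integral (cbox (- a) a) f = 0"
    then have "(f has_integral 0) (cbox (- a) a)"
      using integrable_integral[OF integrable_continuous[OF c]] by simp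
    from has_integral_0_cbox_imp_0[OF c _ this, of y] have "f y = 0" using f(3) yS a ac by blast
    with y show False by simp
  qed
  ultimately show ?thesis using eq by linarith
qed

text \<open>\<open>a / (1 + a)\<close> increases with \<open>a\<close>. The weight of index
  \<open>0\<close> bounds the others below, so the total weight stays positive in the limit.\<close>

lemma shell_weight_0_le: "shell_weight 0 x \<le> shell_weight k x"
proof -
  have "a / (1 + a) \<le> b / (1 + b)" if "0 \<le> a" "a \<le> b" for a b :: real
    using that by (simp add: divide_simps) (simp add: algebra_simps)
  moreover have "real (Suc 0) * shell_bump (x \<bullet> x) \<le> real (Suc k) * shell_bump (x \<bullet> x)"
    by (intro mult_right_mono shell_bump_nonneg) simp
  ultimately show ?thesis
    unfolding shell_weight_def by (simp add: shell_bump_nonneg)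
qed

text \<open>Numerator and denominator of a Rayleigh quotient converge with the same constant, so the
  quotient on the shell tends to the quotient on \<Sigma>.\<close>

lemma shell_weight_tendsto_sphere_integral:
  fixes \<Sigma> :: "'a::euclidean_space set" and q :: "'a \<Rightarrow> real"
  assumes \<Sigma>: "openin (top_of_set (sphere 0 1)) \<Sigma>" and K: "compact K" "K \<subseteq> \<Sigma>"
    and cq: "continuous_on (Cone \<Sigma>) q"
    and hom: "\<And>x. x \<in> Cone \<Sigma> \<Longrightarrow> q x = q (x /\<^sub>R norm x)"
    and q0: "\<And>x. x \<in> Cone \<Sigma> \<Longrightarrow> x /\<^sub>R norm x \<notin> K \<Longrightarrow> q x = 0"
  shows "(\<lambda>k. LINT x|lborel. (if x \<in> Cone \<Sigma> then shell_weight k x * q x else 0)) \<longlonglongrightarrow>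
    (1 - (1/2) ^ DIM('a)) / real DIM('a) * (LINT \<theta>:\<Sigma>|sphere_measure. q \<theta>)"
proof -
  define Q where "Q x = (if x \<in> Cone \<Sigma> then q x else 0)" for x
  have U: "open (Cone \<Sigma>)" by (rule open_Cone[OF \<Sigma>])
  have unit: "norm \<theta> = 1" if "\<theta> \<in> \<Sigma>" for \<theta> using openin_imp_subset[OF \<Sigma>] that by auto
  have "(\<lambda>x. indicator (Cone \<Sigma>) x *\<^sub>R q x) \<in> borel_measurable borel"
    by (rule borel_measurable_continuous_on_indicator) (use U cq in auto)
  also have "(\<lambda>x. indicator (Cone \<Sigma>) x *\<^sub>R q x) = Q" by (auto simp: Q_def indicator_def)
  finally have mQ: "Q \<in> borel_measurable borel" .
  have Qn: "Q x = Q (x /\<^sub>R norm x)" if "x \<noteq> 0" for x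
  proof -
    have "x \<in> Cone \<Sigma> \<longleftrightarrow> x /\<^sub>R norm x \<in> Cone \<Sigma>"
      using that Cone_unit[of "x /\<^sub>R norm x" \<Sigma>] by (simp add: Cone_def)
    then show ?thesis using hom[of x] by (auto simp: Q_def)
  qed
  have Q0: "Q 0 = 0" by (simp add: Q_def Cone_def)
  have hQ: "Q (s *\<^sub>R x) = Q x" if "s > 0" for s x
  proof (cases "x = 0")
    case False
    then have "Q (s *\<^sub>R x) = Q ((s *\<^sub>R x) /\<^sub>R norm (s *\<^sub>R x))" using that by (intro Qn) auto
    also have "\<dots> = Q x" unfolding normalize_scaleR[OF that] using Qn[OF False] by simp
    finally show ?thesis .
  qed simp
  have KC: "K \<subseteq> Cone \<Sigma>" using K(2) unit Cone_unit by blast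
  have "bounded (q ` K)"
    by (rule compact_imp_bounded[OF compact_continuous_image[OF continuous_on_subset[OF cq KC] K(1)]])
  then obtain B where B: "\<And>\<theta>. \<theta> \<in> K \<Longrightarrow> \<bar>q \<theta>\<bar> \<le> B" unfolding bounded_iff by auto
  have bQ: "\<bar>Q x\<bar> \<le> \<bar>B\<bar>" for x
  proof (cases "x \<in> Cone \<Sigma> \<and> x /\<^sub>R norm x \<in> K")
    case True
    then show ?thesis using B[of "x /\<^sub>R norm x"] hom[of x] by (simp add: Q_def)
  next
    case False
    then have "Q x = 0" using q0 by (auto simp: Q_def)
    then show ?thesis by simp
  qed
  have eq: "indicator \<Sigma> \<theta> *\<^sub>R q \<theta> = indicator (sphere 0 1) \<theta> * Q \<theta>" for \<theta>
    using unit[of \<theta>] Cone_unit[of \<theta> \<Sigma>] by (auto simp: Q_def indicator_def)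
  have "(LINT \<theta>:\<Sigma>|sphere_measure. q \<theta>) = (LINT \<theta>|sphere_measure. indicator (sphere 0 1) \<theta> * Q \<theta>)"
    unfolding set_lebesgue_integral_def eq ..
  also have "\<dots> = real DIM('a) * (LINT x|lborel. indicator (ball 0 1 - {0}) x *
      (indicator (sphere 0 1) (x /\<^sub>R norm x) * Q (x /\<^sub>R norm x)))"
    by (rule integral_sphere_measure)
      (intro borel_measurable_times borel_measurable_indicator mQ borel_closed closed_sphere)
  also have "(LINT x|lborel. indicator (ball 0 1 - {0}) x * (indicator (sphere 0 1) (x /\<^sub>R norm x) * Q (x /\<^sub>R norm x)))
      = (LINT x|lborel. indicator (ball 0 1 - {0}) x * Q x)"
  proof (rule Bochner_Integration.integral_cong[OF refl])
    fix x :: 'a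
    show "indicator (ball 0 1 - {0}) x * (indicator (sphere 0 1) (x /\<^sub>R norm x) * Q (x /\<^sub>R norm x))
      = indicator (ball 0 1 - {0}) x * Q x"
      using Qn[of x] by (cases "x = 0") (simp_all add: indicator_def)
  qed
  finally have sph: "(LINT x|lborel. indicator (ball 0 1 - {0}) x * Q x) =
      (LINT \<theta>:\<Sigma>|sphere_measure. q \<theta>) / real DIM('a)" by simp
  have "(if x \<in> Cone \<Sigma> then shell_weight k x * q x else 0) = shell_weight k x * Q x" for k x
    by (simp add: Q_def)
  then show ?thesis
    using integral_shell_weight_tendsto[OF mQ hQ bQ] by (simp add: sph)
qed

section \<open>Frequency, eigenvalue and the contradiction\<close>

text \<open>For a positive eigenvalue the quadratic has exactly one positive root \<open>z\<close>,
  so the description in \<open>frequency\<close> denotes it, and \<open>z * (z + b)\<close> is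
  monotone. For an eigenvalue \<le> 0 there is no positive root and the frequency carries no
  information, but the right side is nonnegative.\<close>

lemma frequency_le_imp_eigenvalue_le:
  fixes \<Sigma> :: "'a::euclidean_space set"
  assumes "DIM('a) \<ge> 2" "\<alpha> > 0" "\<alpha> \<ge> frequency \<Sigma>"
  shows "dirichlet_eigenvalue \<Sigma> \<le> \<alpha> * (\<alpha> + real DIM('a) - 2)"
proof (cases "dirichlet_eigenvalue \<Sigma> > 0")
  case True
  define b where "b = real DIM('a) - 2"
  define e where "e = dirichlet_eigenvalue \<Sigma>"
  have b: "b \<ge> 0" using assms(1) by (simp add: b_def)
  have e: "e > 0" using True by (simp add: e_def)
  define z where "z = (sqrt (b\<^sup>2 + 4 * e) - b) / 2"
  have "b < sqrt (b\<^sup>2 + 4 * e)" using e by (intro real_less_rsqrt) simp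
  then have z: "z > 0" by (simp add: z_def)
  have "2 * z + b = sqrt (b\<^sup>2 + 4 * e)" by (simp add: z_def diff_divide_distrib)
  then have "(2 * z + b)\<^sup>2 = b\<^sup>2 + 4 * e" using e by simp
  then have ze: "z * (z + b) = e" by (simp add: power2_eq_square algebra_simps)
  have uniq: "y = z" if "y > 0" "y * (y + b) = e" for y
  proof -
    have "(y - z) * (y + z + b) = 0" using that(2) ze by (simp add: algebra_simps)
    moreover have "y + z + b > 0" using that(1) z b by linarith
    ultimately show ?thesis by auto
  qed
  have "frequency \<Sigma> = (THE \<phi>. 0 < \<phi> \<and> \<phi> * (\<phi> + b) = e)"
    unfolding frequency_def b_def e_def add_diff_eq ..
  also have "\<dots> = z" by (rule the_equality) (use z ze uniq in blast)+
  finally have "frequency \<Sigma> = z" .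
  then have "z \<le> \<alpha>" using assms(3) by simp
  then have "z * (z + b) \<le> \<alpha> * (\<alpha> + b)" using z b by (intro mult_mono) auto
  then show ?thesis using ze by (simp add: b_def e_def algebra_simps)
next
  case False
  have "\<alpha> * (\<alpha> + real DIM('a) - 2) \<ge> 0" using assms(1,2) by (intro mult_nonneg_nonneg) auto
  then show ?thesis using False by linarith
qed

lemma exists_test_function:
  assumes \<Sigma>: "openin (top_of_set (sphere 0 1)) \<Sigma>" "\<Sigma> \<noteq> {}" and "dirichlet_eigenvalue \<Sigma> < L"
  obtains F \<theta> where "Cinf_compact_support \<Sigma> F" "\<theta> \<in> \<Sigma>" "F \<theta> \<noteq> 0"
    "(LINT \<theta>:\<Sigma>|sphere_measure. (norm (sphere_grad \<Sigma> F \<theta>))\<^sup>2) /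
        (LINT \<theta>:\<Sigma>|sphere_measure. (F \<theta>)\<^sup>2) < L"
proof -
  let ?A = "{F. Cinf_compact_support \<Sigma> F \<and> (\<exists>\<theta>\<in>\<Sigma>. F \<theta> \<noteq> 0)}"
  let ?R = "\<lambda>F. (LINT \<theta>:\<Sigma>|sphere_measure. (norm (sphere_grad \<Sigma> F \<theta>))\<^sup>2) /
        (LINT \<theta>:\<Sigma>|sphere_measure. (F \<theta>)\<^sup>2)"
  have "?A \<noteq> {}" using Cinf_compact_support_exists[OF \<Sigma>] by blast
  then have ne: "?R ` ?A \<noteq> {}" by (simp only: image_is_empty not_False_eq_True)
  have "Inf (?R ` ?A) < L" using assms(3) by (simp only: dirichlet_eigenvalue_def)
  from cInf_lessD[OF ne this] obtain F where F: "F \<in> ?A" "?R F < L"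
    by (elim bexE imageE) (simp only:)
  then obtain \<theta> where "\<theta> \<in> \<Sigma>" "F \<theta> \<noteq> 0" by (simp only: mem_Collect_eq) (elim conjE bexE)
  moreover have "Cinf_compact_support \<Sigma> F" using F(1) by (simp only: mem_Collect_eq)
  ultimately show thesis using F(2) that by simp
qed

text \<open>The bound \<open>M\<close> depends on \<open>u\<close> alone, so the tolerance
  \<open>eps\<close> can be fixed through \<open>M\<close> before the test function is
  chosen.\<close>

lemma no_global_solution:
  fixes \<Sigma> :: "'a::euclidean_space set"
  assumes n: "DIM('a) \<ge> 2" and \<Sigma>: "openin (top_of_set (sphere 0 1)) \<Sigma>" "\<Sigma> \<noteq> {}"
    and \<gamma>: "\<gamma> > 0" and lam: "lam > 0" and f: "\<And>x. x \<in> Cone \<Sigma> \<Longrightarrow> f x \<ge> lam"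
    and freq: "frequency \<Sigma> \<le> 2 / (1 + \<gamma>)"
  shows "\<not> global_solution \<gamma> f \<Sigma> u"
proof
  assume u: "global_solution \<gamma> f \<Sigma> u"
  define \<alpha> where "\<alpha> = 2 / (1 + \<gamma>)"
  define p where "p = 1 + \<gamma>"
  define U where "U = Cone \<Sigma>"
  have \<alpha>: "\<alpha> > 0" "\<alpha> * p = 2" "p > 0" using \<gamma> by (simp_all add: \<alpha>_def p_def field_simps)
  have U: "open U" unfolding U_def by (rule open_Cone[OF \<Sigma>(1)])
  have unit: "norm \<theta> = 1" if "\<theta> \<in> \<Sigma>" for \<theta> using openin_imp_subset[OF \<Sigma>(1)] that by auto
  have uC: "Ck_on 2 U u" "continuous_on (closure U) u" and upos: "\<And>x. x \<in> U \<Longrightarrow> u x > 0"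
    using u by (auto simp: global_solution_def U_def)
  have "laplacian u x \<le> - lam * u x powr (- \<gamma>)" if x: "x \<in> U" for x
  proof -
    have "lam * u x powr (- \<gamma>) \<le> f x * u x powr (- \<gamma>)"
      using f x by (intro mult_right_mono) (auto simp: U_def)
    moreover have "- laplacian u x = f x * u x powr (- \<gamma>)"
      using u x by (simp add: global_solution_def U_def)
    ultimately show ?thesis by linarith
  qed
  then obtain g H where gH:
    "\<And>x. x \<in> U \<Longrightarrow> ((\<lambda>x. ln (u x)) has_derivative (\<lambda>h. g x \<bullet> h)) (at x)"
    "\<And>x. x \<in> U \<Longrightarrow> (g has_derivative H x) (at x)"
    "\<And>e. continuous_on U (\<lambda>x. H x e)"
    "\<And>x. x \<in> U \<Longrightarrow> (\<Sum>i\<in>Basis. H x i \<bullet> i) + (norm (g x))\<^sup>2 + lam * exp (- p * ln (u x)) \<le> 0"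
    using log_supersolution[OF uC(1) upos, of lam \<gamma>] unfolding p_def by blast
  \<comment> \<open>Continuity up to the boundary, vertex included, bounds \<open>u\<close> on the
    truncated cone.\<close>
  have "compact (u ` (closure U \<inter> cball 0 1))"
    by (intro compact_continuous_image continuous_on_subset[OF uC(2)])
      (auto simp: closed_Int_compact)
  then have "bounded (u ` (closure U \<inter> cball 0 1))" by (rule compact_imp_bounded)
  then obtain B where B: "\<forall>x \<in> closure U \<inter> cball 0 1. \<bar>u x\<bar> \<le> B"
    unfolding bounded_iff by auto
  define M where "M = ln (max B 1)"
  have uM: "ln (u x) \<le> M" if "x \<in> U" "norm x \<le> 1" for x
    using B[rule_format, of x] that closure_subset[of U] upos[OF that(1)] unfolding M_def
    by (subst ln_le_cancel_iff) auto
  \<comment> \<open>Half of the quantity that will be shown to be at most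
    \<open>eps\<close>.\<close>
  define eps where "eps = lam / 8 * exp (- p * M)"
  have eps: "eps > 0" using lam by (simp add: eps_def)
  define L where "L = \<alpha> * (\<alpha> + real DIM('a) - 2) + eps"
  have "dirichlet_eigenvalue \<Sigma> < L"
    using frequency_le_imp_eigenvalue_le[OF n \<alpha>(1), of \<Sigma>] freq eps by (simp add: L_def \<alpha>_def)
  then obtain F \<theta>0 where F: "Cinf_compact_support \<Sigma> F" "\<theta>0 \<in> \<Sigma>" "F \<theta>0 \<noteq> 0" and
    R: "(LINT \<theta>:\<Sigma>|sphere_measure. (norm (sphere_grad \<Sigma> F \<theta>))\<^sup>2) /
        (LINT \<theta>:\<Sigma>|sphere_measure. (F \<theta>)\<^sup>2) < L"
    using exists_test_function[OF \<Sigma>] by metis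
  define E where "E x = F (x /\<^sub>R norm x)" for x
  obtain K dF where K: "compact K" "K \<subseteq> \<Sigma>"
    and dE: "\<And>x. x \<in> U \<Longrightarrow> (E has_derivative (\<lambda>h. dF x \<bullet> h)) (at x)"
    and cdF: "continuous_on U dF" and dFx: "\<And>x. x \<in> U \<Longrightarrow> dF x \<bullet> x = 0"
    and sg: "\<And>x. x \<in> U \<Longrightarrow> sphere_grad \<Sigma> F (x /\<^sub>R norm x) = norm x *\<^sub>R dF x"
    and E0: "\<And>x. x \<in> U \<Longrightarrow> x /\<^sub>R norm x \<notin> K \<Longrightarrow> E x = 0 \<and> dF x = 0"
    by (rule radial_extension[OF \<Sigma>(1) F(1), folded U_def E_def]) (rule that)
  have cE: "continuous_on U E"
    by (rule has_derivative_continuous_on, rule has_derivative_at_withinI, erule dE)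
  have E\<Sigma>: "E \<theta> = F \<theta>" if "\<theta> \<in> \<Sigma>" for \<theta> using unit[OF that] by (simp add: E_def)
  have \<Sigma>U: "\<theta> \<in> U" if "\<theta> \<in> \<Sigma>" for \<theta> using that Cone_unit[OF unit[OF that]] by (simp add: U_def)
  have n\<Sigma>: "x /\<^sub>R norm x \<in> \<Sigma>" if "x \<in> U" for x using that by (simp add: U_def Cone_def)
  define N where "N k = (LINT x|lborel. (if x \<in> U then shell_weight k x * ((norm x)\<^sup>2 * (norm (dF x))\<^sup>2) else 0))" for k
  define D where "D k = (LINT x|lborel. (if x \<in> U then shell_weight k x * (E x)\<^sup>2 else 0))" for k
  define c where "c = (1 - (1/2) ^ DIM('a)) / real DIM('a)"
  have c: "c > 0" unfolding c_def by (auto intro!: divide_pos_pos power_less_one_iff[THEN iffD2])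
  \<comment> \<open>The factor \<open>(norm x)\<^sup>2\<close> makes the Dirichlet density constant
    along rays.\<close>
  have grad_eq: "(norm x)\<^sup>2 * (norm (dF x))\<^sup>2 = (norm (sphere_grad \<Sigma> F (x /\<^sub>R norm x)))\<^sup>2" if "x \<in> U" for x
    using sg[OF that] by (simp add: power_mult_distrib)
  have hom: "(norm x)\<^sup>2 * (norm (dF x))\<^sup>2 =
      (norm (x /\<^sub>R norm x))\<^sup>2 * (norm (dF (x /\<^sub>R norm x)))\<^sup>2" if x: "x \<in> U" for x
  proof -
    let ?t = "x /\<^sub>R norm x"
    have "(norm ?t)\<^sup>2 * (norm (dF ?t))\<^sup>2 = (norm (sphere_grad \<Sigma> F (?t /\<^sub>R norm ?t)))\<^sup>2"
      by (rule grad_eq[OF \<Sigma>U[OF n\<Sigma>[OF x]]])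
    also have "?t /\<^sub>R norm ?t = ?t" by (rule normalize_unit[OF unit[OF n\<Sigma>[OF x]]])
    finally show ?thesis using grad_eq[OF x] by simp
  qed
  have Nlim: "N \<longlonglongrightarrow> c * (LINT \<theta>:\<Sigma>|sphere_measure. (norm (sphere_grad \<Sigma> F \<theta>))\<^sup>2)"
  proof -
    have "N \<longlonglongrightarrow> c * (LINT \<theta>:\<Sigma>|sphere_measure. (norm \<theta>)\<^sup>2 * (norm (dF \<theta>))\<^sup>2)"
      unfolding N_def[abs_def] c_def
    proof (rule shell_weight_tendsto_sphere_integral[OF \<Sigma>(1) K, folded U_def])
      show "(norm x)\<^sup>2 * (norm (dF x))\<^sup>2 = (norm (x /\<^sub>R norm x))\<^sup>2 * (norm (dF (x /\<^sub>R norm x)))\<^sup>2"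
        if "x \<in> U" for x by (rule hom[OF that])
      show "continuous_on U (\<lambda>x. (norm x)\<^sup>2 * (norm (dF x))\<^sup>2)" by (intro continuous_intros cdF)
      show "(norm x)\<^sup>2 * (norm (dF x))\<^sup>2 = 0" if "x \<in> U" "x /\<^sub>R norm x \<notin> K" for x
        using E0[OF that] by simp
    qed
    also have "(LINT \<theta>:\<Sigma>|sphere_measure. (norm \<theta>)\<^sup>2 * (norm (dF \<theta>))\<^sup>2) =
        (LINT \<theta>:\<Sigma>|sphere_measure. (norm (sphere_grad \<Sigma> F \<theta>))\<^sup>2)"
      unfolding set_lebesgue_integral_def
    proof (rule Bochner_Integration.integral_cong[OF refl])
      fix \<theta> :: 'a
      show "indicator \<Sigma> \<theta> *\<^sub>R ((norm \<theta>)\<^sup>2 * (norm (dF \<theta>))\<^sup>2) = indicator \<Sigma> \<theta> *\<^sub>R (norm (sphere_grad \<Sigma> F \<theta>))\<^sup>2"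
        using grad_eq[OF \<Sigma>U] normalize_unit[OF unit] by (cases "\<theta> \<in> \<Sigma>") auto
    qed
    finally show ?thesis .
  qed
  have Dlim: "D \<longlonglongrightarrow> c * (LINT \<theta>:\<Sigma>|sphere_measure. (F \<theta>)\<^sup>2)"
  proof -
    have "D \<longlonglongrightarrow> c * (LINT \<theta>:\<Sigma>|sphere_measure. (E \<theta>)\<^sup>2)"
      unfolding D_def[abs_def] c_def
    proof (rule shell_weight_tendsto_sphere_integral[OF \<Sigma>(1) K, folded U_def])
      show "continuous_on U (\<lambda>x. (E x)\<^sup>2)" by (intro continuous_intros cE)
      fix x assume x: "x \<in> U"
      have "E x = E (x /\<^sub>R norm x)" using E\<Sigma>[OF n\<Sigma>[OF x]] by (simp only: E_def)
      then show "(E x)\<^sup>2 = (E (x /\<^sub>R norm x))\<^sup>2" by (rule arg_cong)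
      assume "x /\<^sub>R norm x \<notin> K"
      then show "(E x)\<^sup>2 = 0" using E0[OF x] by simp
    qed
    also have "(LINT \<theta>:\<Sigma>|sphere_measure. (E \<theta>)\<^sup>2) = (LINT \<theta>:\<Sigma>|sphere_measure. (F \<theta>)\<^sup>2)"
      unfolding set_lebesgue_integral_def
    proof (rule Bochner_Integration.integral_cong[OF refl])
      fix \<theta> :: 'a
      show "indicator \<Sigma> \<theta> *\<^sub>R (E \<theta>)\<^sup>2 = indicator \<Sigma> \<theta> *\<^sub>R (F \<theta>)\<^sup>2"
        using E\<Sigma>[of \<theta>] by (cases "\<theta> \<in> \<Sigma>") auto
    qed
    finally show ?thesis .
  qed
  \<comment> \<open>The part of the closed shell over \<open>K\<close>: compact, inside the open
    cone, and a common support for all weights.\<close>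
  define S where "S = (\<lambda>(t, \<theta>). t *\<^sub>R \<theta>) ` ({1/2..1::real} \<times> K)"
  have S: "compact S" unfolding S_def
    by (intro compact_continuous_image compact_Times compact_Icc K(1))
      (auto simp: split_beta intro!: continuous_intros)
  have SU: "S \<subseteq> U"
    using K(2) \<Sigma>U Cone_scaleR[of _ \<Sigma>] by (auto simp: S_def U_def)
  have Sn: "1/2 \<le> norm x" "norm x \<le> 1" if "x \<in> S" for x
    using that K(2) unit by (auto simp: S_def)
  have supp: "shell_weight k x = 0 \<or> E x = 0 \<and> dF x = 0" if "x \<in> U - S" for x and k
  proof (cases "1/2 < norm x \<and> norm x < 1")
    case True
    have "x /\<^sub>R norm x \<notin> K"
    proof
      assume "x /\<^sub>R norm x \<in> K"
      moreover have "x = norm x *\<^sub>R (x /\<^sub>R norm x)" using True by (cases "x = 0") simp_all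
      ultimately have "x \<in> S" unfolding S_def using True
        by (intro image_eqI[of _ _ "(norm x, x /\<^sub>R norm x)"]) auto
      with that show False by simp
    qed
    then show ?thesis using E0 that by blast
  next
    case False then show ?thesis using shell_weight_eq_0 by blast
  qed
  have c\<rho>: "continuous_on UNIV (shell_weight k :: 'a \<Rightarrow> real)" for k
  proof -
    obtain r :: "'a \<Rightarrow> real" where r: "\<And>x. (shell_weight k has_derivative (\<lambda>h. r x * (x \<bullet> h))) (at x)"
      and "continuous_on UNIV r" by (rule shell_weight_C1[of k]) (rule that)
    show ?thesis by (rule has_derivative_continuous_on, rule has_derivative_at_withinI, rule r)
  qed
  have s0: "shell_weight k x * (E x)\<^sup>2 = 0" if "x \<in> U - S" for k x using supp[OF that, of k] by auto
  have cD: "continuous_on U (\<lambda>x. shell_weight k x * (E x)\<^sup>2)" for k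
    by (intro continuous_intros cE continuous_on_subset[OF c\<rho>]) auto
  have Dpos: "D k > 0" for k
    unfolding D_def
  proof (rule integral_pos_compact_support[OF S])
    show "continuous_on UNIV (\<lambda>x. if x \<in> U then shell_weight k x * (E x)\<^sup>2 else 0)"
      by (rule continuous_if_compact_support[OF U S SU cD s0])
    show "(if x \<in> U then shell_weight k x * (E x)\<^sup>2 else 0) = 0" if "x \<notin> S" for x
      using s0[of x k] that by auto
    show "(if x \<in> U then shell_weight k x * (E x)\<^sup>2 else 0) \<ge> 0" for x
      using shell_weight_bounds(1)[of k x] by auto
    let ?y = "(3/4) *\<^sub>R \<theta>0"
    have "?y \<in> U" using Cone_scaleR[of \<theta>0 \<Sigma> "3/4"] \<Sigma>U[OF F(2)] by (simp add: U_def)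
    moreover have "shell_weight k ?y > 0" by (rule shell_weight_pos) (use unit[OF F(2)] in auto)
    moreover have "E ?y = F \<theta>0"
      unfolding E_def by (subst normalize_scaleR) (use unit[OF F(2)] in auto)
    ultimately show "(if ?y \<in> U then shell_weight k ?y * (E ?y)\<^sup>2 else 0) > 0" using F(3) by simp
  qed
  have "D 0 \<le> D k" for k
    unfolding D_def
  proof (rule integral_mono)
    show "(if x \<in> U then shell_weight 0 x * (E x)\<^sup>2 else 0) \<le> (if x \<in> U then shell_weight k x * (E x)\<^sup>2 else 0)" for x
      using shell_weight_0_le[of x k] by (auto intro: mult_right_mono)
  qed (use integrable_if_compact_support(2)[OF U S SU cD s0] in blast)+
  then have "D 0 \<le> c * (LINT \<theta>:\<Sigma>|sphere_measure. (F \<theta>)\<^sup>2)"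
    by (intro LIMSEQ_le_const[OF Dlim]) auto
  then have "c * (LINT \<theta>:\<Sigma>|sphere_measure. (F \<theta>)\<^sup>2) > 0" using Dpos[of 0] by linarith
  then have FF: "(LINT \<theta>:\<Sigma>|sphere_measure. (F \<theta>)\<^sup>2) > 0" using c by (simp add: zero_less_mult_iff)
  have "(LINT \<theta>:\<Sigma>|sphere_measure. (norm (sphere_grad \<Sigma> F \<theta>))\<^sup>2) < L * (LINT \<theta>:\<Sigma>|sphere_measure. (F \<theta>)\<^sup>2)"
    using R FF by (simp add: pos_divide_less_eq)
  from mult_strict_left_mono[OF this c]
  have "c * (LINT \<theta>:\<Sigma>|sphere_measure. (norm (sphere_grad \<Sigma> F \<theta>))\<^sup>2)
      < L * (c * (LINT \<theta>:\<Sigma>|sphere_measure. (F \<theta>)\<^sup>2))"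
    by (simp only: mult.left_commute[of c L])
  \<comment> \<open>Strict inequality in the limit allows stopping at a finite index, where the
    weight is still differentiable.\<close>
  then have "\<forall>\<^sub>F k in sequentially. 0 < L * D k - N k"
    by (intro order_tendstoD(1)[OF tendsto_diff[OF tendsto_mult_left[OF Dlim] Nlim]]) simp
  then obtain k where "0 < L * D k - N k"
    unfolding eventually_sequentially by blast
  then have k: "N k \<le> L * D k" by simp
  obtain r :: "'a \<Rightarrow> real" where r: "\<And>x. (shell_weight k has_derivative (\<lambda>h. r x * (x \<bullet> h))) (at x)"
    "continuous_on UNIV r" by (rule shell_weight_C1[of k]) (rule that)
  have "lam / 4 * exp (- p * M) \<le> eps"
  proof (rule supersolution_cone_bound[OF U _ S SU _ gH lam \<alpha>(3,2) _ dE cdF dFx r(1) _ r(2)])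
    show "s *\<^sub>R x \<in> U" if "x \<in> U" "s > 0" for x s using that Cone_scaleR by (simp add: U_def)
    show "2 \<le> real DIM('a)" using n by simp
    show "shell_weight k x = 0 \<or> E x = 0 \<and> dF x = 0" if "x \<in> U - S" for x by (rule supp[OF that])
    show "0 < (LINT x|lborel. (if x \<in> U then shell_weight k x * (E x)\<^sup>2 else 0))"
      using Dpos[of k] by (simp only: D_def)
    show "(LINT x|lborel. (if x \<in> U then shell_weight k x * ((norm x)\<^sup>2 * (norm (dF x))\<^sup>2) else 0)) \<le>
      (\<alpha> * (\<alpha> + real DIM('a) - 2) + eps) * (LINT x|lborel. (if x \<in> U then shell_weight k x * (E x)\<^sup>2 else 0))"
      using k by (simp only: N_def D_def L_def)
    show "ln (u x) \<le> M" if "x \<in> S" for x using uM[of x] that SU Sn(2) by blast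
  qed (use Sn(1) eps shell_weight_bounds in auto)
  then show False using lam by (simp add: eps_def)
qed

theorem theorem1p1:
  fixes \<gamma> \<alpha> \<phi> lam :: real
    and \<Sigma> :: "((real ^ 'm) \<times> real) set"
    and f :: "(real ^ 'm) \<times> real \<Rightarrow> real"
  assumes "\<gamma> > 0"
    and "\<alpha> = 2 / (1 + \<gamma>)"
    and "lipschitz_epigraphical_cone \<Sigma>"
    and "\<phi> = frequency \<Sigma>"
    and "lam > 0"
    and "\<forall>X\<in>Cone \<Sigma>. f X \<ge> lam"
    and "\<alpha> \<ge> \<phi>"
  shows "\<nexists>u. global_solution \<gamma> f \<Sigma> u"
proof -
  have \<Sigma>: "openin (top_of_set (sphere 0 1)) \<Sigma>"
    using assms(3) by (simp add: lipschitz_epigraphical_cone_def)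
  obtain g where g: "Cone \<Sigma> = {(x', xn). (g x' :: real) < xn}"
    using assms(3) unfolding lipschitz_epigraphical_cone_def by blast
  \<comment> \<open>A point above the graph shows that \<Sigma> is nonempty and thus carries test
    functions.\<close>
  have "(0, g 0 + 1) \<in> Cone \<Sigma>" unfolding g by simp
  then have ne: "\<Sigma> \<noteq> {}" by (auto simp: Cone_def)
  have "CARD('m) \<ge> 1" by (simp add: Suc_leI)
  then have "DIM((real ^ 'm) \<times> real) \<ge> 2" by simp
  then show ?thesis
    using no_global_solution[OF _ \<Sigma> ne assms(1,5), of f] assms by auto
qed

end
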